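(* Let $N>1$, $p\ge 2$, $s\in(0,1)$, $N>ps$, and let $\Omega\subset\mathbb{R}^N$ be a bounded domain with $C^{1,1}$ boundary. Let $f:\Omega\times\mathbb{R}\to\mathbb{R}$ be a Carathéodory function such that, for some $c_0>0$ and $q\in(p,p_s^* )$, $|f(x,t)|\le c_0(1+|t|^{q-1})$ for a.e. $x\in\Omega$ and all $t\in\mathbb{R}$. Let $(\underline{u},\overline{u})\in\widetilde{W}^{s,p}(\Omega)\times\widetilde{W}^{s,p}(\Omega)$ be a sub-supersolution pair of the problem $$(-\Delta)_p^s u=f(x,u)\ \text{ in }\Omega,\qquad u=0\ \text{ in }\Omega^c.$$ Then $\mathcal{S}(\underline{u},\overline{u})$ is compact in $W^{s,p}_0(\Omega)$ (with respect to the norm topology).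
   Context: Notation: $\Omega^c=\mathbb{R}^N\setminus\Omega$, $p_s^*=Np/(N-ps)$, $d\mu=|x-y|^{-N-ps}\,dx\,dy$. Inequalities between measurable functions hold almost everywhere. Functions on $\Omega$ are identified with their $0$-extension to $\mathbb{R}^N$. Spaces: $[u]_{s,p}^p=\iint_{\mathbb{R}^N\times\mathbb{R}^N}|u(x)-u(y)|^p\,d\mu$; $W^{s,p}(\mathbb{R}^N)=\{u\in L^p(\mathbb{R}^N):[u]_{s,p}<\infty\}$; $W^{s,p}_0(\Omega)=\{u\in W^{s,p}(\mathbb{R}^N):u=0\text{ in }\Omega^c\}$, normed by $\|u\|_{s,p}=[u]_{s,p}$, with dual $W^{-s,p'}(\Omega)$; $W^{s,p}_0(\Omega)_+$ is the set of its a.e. non-negative elements. For $U\subseteq\mathbb{R}^N$ open, $W^{s,p}(U)$ is the usual fractional Sobolev space ($u\in L^p(U)$ with $\iint_{U\times U}|u(x)-u(y)|^p\,d\mu<\infty$). $\widetilde{W}^{s,p}(\Omega)$ is the space of all $u\in L^p_{\rm loc}(\mathbb{R}^N)$ such that $u\in W^{s,p}(U)$ for some open $U\subseteq\mathbb{R}^N$ with $\overline\Omega\subset U$, and $\int_{\mathbb{R}^N}\frac{|u(x)|^{p-1}}{(1+|x|)^{N+ps}}\,dx<\infty$. Operator: for $u\in\widetilde{W}^{s,p}(\Omega)$, $(-\Delta)_p^su\in W^{-s,p'}(\Omega)$ is defined by $$\langle(-\Delta)_p^su,v\rangle=\iint_{\mathbb{R}^N\times\mathbb{R}^N}|u(x)-u(y)|^{p-2}(u(x)-u(y))(v(x)-v(y))\,d\mu,\quad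 v\in W^{s,p}_0(\Omega).$$ Definitions: $u\in\widetilde{W}^{s,p}(\Omega)$ is a supersolution if $u\ge0$ in $\Omega^c$ and $\langle(-\Delta)_p^su,v\rangle\ge\int_\Omega f(x,u)v\,dx$ for all $v\in W^{s,p}_0(\Omega)_+$; it is a subsolution if $u\le0$ in $\Omega^c$ and $\langle(-\Delta)_p^su,v\rangle\le\int_\Omega f(x,u)v\,dx$ for all $v\in W^{s,p}_0(\Omega)_+$. $u\in W^{s,p}_0(\Omega)$ is a solution if $\langle(-\Delta)_p^su,v\rangle=\int_\Omega f(x,u)v\,dx$ for all $v\in W^{s,p}_0(\Omega)$. $(\underline{u},\overline{u})$ is a sub-supersolution pair if $\underline{u}$ is a subsolution, $\overline{u}$ is a supersolution, and $\underline{u}\le\overline{u}$ in $\Omega$. For such a pair, $\mathcal{S}(\underline{u},\overline{u})=\{u\in W^{s,p}_0(\Omega):u\text{ is a solution},\ \underline{u}\le u\le\overline{u}\}$. *)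

theory Defs
  imports "HOL-Analysis.Analysis"
begin

section \<open>Fractional Sobolev spaces\<close>

text \<open>
  The measure \<open>d\<mu> = |x - y|^(-N-ps) dx dy\<close> with \<open>N = DIM('a)\<close>. On the diagonal, a null set, the
  density takes the junk value \<open>0 powr _ = 0\<close>.
\<close>

definition frac_measure :: "real \<Rightarrow> real \<Rightarrow> ('a::euclidean_space \<times> 'a) measure" where
  "frac_measure s p =
     density (lebesgue \<Otimes>\<^sub>M lebesgue)
       (\<lambda>(x, y). ennreal (norm (x - y) powr (- (real DIM('a) + p * s))))"

definition gagliardo_int :: "real \<Rightarrow> real \<Rightarrow> 'a::euclidean_space set \<Rightarrow> ('a \<Rightarrow> real) \<Rightarrow> ennreal" where
  "gagliardo_int s p U u =
     (\<integral>\<^sup>+z\<in>U \<times> U. ennreal (\<bar>u (fst z) - u (snd z)\<bar> powr p) \<partial>frac_measure s p)"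

definition gagliardo_seminorm :: "real \<Rightarrow> real \<Rightarrow> ('a::euclidean_space \<Rightarrow> real) \<Rightarrow> real" where
  "gagliardo_seminorm s p u = enn2real (gagliardo_int s p UNIV u) powr (1 / p)"

definition W_sp :: "real \<Rightarrow> real \<Rightarrow> 'a::euclidean_space set \<Rightarrow> ('a \<Rightarrow> real) set" where
  "W_sp s p U =
     {u. u \<in> borel_measurable (lebesgue_on U) \<and>
         (\<integral>\<^sup>+x. ennreal (\<bar>u x\<bar> powr p) \<partial>lebesgue_on U) < \<infinity> \<and>
         gagliardo_int s p U u < \<infinity>}"

definition W0_sp :: "real \<Rightarrow> real \<Rightarrow> 'a::euclidean_space set \<Rightarrow> ('a \<Rightarrow> real) set" where
  "W0_sp s p \<Omega> = {u \<in> W_sp s p UNIV. AE x in lebesgue_on (- \<Omega>). u x = 0}"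

definition W0_sp_nonneg :: "real \<Rightarrow> real \<Rightarrow> 'a::euclidean_space set \<Rightarrow> ('a \<Rightarrow> real) set" where
  "W0_sp_nonneg s p \<Omega> = {u \<in> W0_sp s p \<Omega>. AE x in lebesgue. 0 \<le> u x}"

definition Lp_loc :: "real \<Rightarrow> ('a::euclidean_space \<Rightarrow> real) set" where
  "Lp_loc p =
     {u \<in> borel_measurable lebesgue.
        \<forall>K. compact K \<longrightarrow> (\<integral>\<^sup>+x\<in>K. ennreal (\<bar>u x\<bar> powr p) \<partial>lebesgue) < \<infinity>}"

definition W_tilde :: "real \<Rightarrow> real \<Rightarrow> 'a::euclidean_space set \<Rightarrow> ('a \<Rightarrow> real) set" where
  "W_tilde s p \<Omega> =
     {u \<in> Lp_loc p.
        (\<exists>U. open U \<and> closure \<Omega> \<subseteq> U \<and> u \<in> W_sp s p U) \<and>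
        (\<integral>\<^sup>+x. ennreal (\<bar>u x\<bar> powr (p - 1) / (1 + norm x) powr (real DIM('a) + p * s)) \<partial>lebesgue) < \<infinity>}"

definition p_star :: "'a::euclidean_space itself \<Rightarrow> real \<Rightarrow> real \<Rightarrow> real" where
  "p_star _ s p = real DIM('a) * p / (real DIM('a) - p * s)"


section \<open>The fractional p-Laplacian; sub- and supersolutions\<close>

text \<open>
  The operator is given through its pairing with a test function. For bounded \<open>\<Omega>\<close>, \<open>u\<close> in
  \<open>W_tilde s p \<Omega>\<close> and \<open>v\<close> in \<open>W0_sp s p \<Omega>\<close> the double integral converges absolutely, so the
  default value 0 of the Bochner integral does not interfere.
\<close>

definition frac_p_laplacian ::
    "real \<Rightarrow> real \<Rightarrow> ('a::euclidean_space \<Rightarrow> real) \<Rightarrow> ('a \<Rightarrow> real) \<Rightarrow> real" where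
  "frac_p_laplacian s p u v =
     (\<integral>z. \<bar>u (fst z) - u (snd z)\<bar> powr (p - 2) * (u (fst z) - u (snd z)) * (v (fst z) - v (snd z))
        \<partial>frac_measure s p)"

definition supersolution ::
    "real \<Rightarrow> real \<Rightarrow> 'a::euclidean_space set \<Rightarrow> ('a \<Rightarrow> real \<Rightarrow> real) \<Rightarrow> ('a \<Rightarrow> real) \<Rightarrow> bool" where
  "supersolution s p \<Omega> f u \<longleftrightarrow>
     u \<in> W_tilde s p \<Omega> \<and> (AE x in lebesgue_on (- \<Omega>). 0 \<le> u x) \<and>
     (\<forall>v\<in>W0_sp_nonneg s p \<Omega>. frac_p_laplacian s p u v \<ge> (LINT x:\<Omega>|lebesgue. f x (u x) * v x))"

definition subsolution ::
    "real \<Rightarrow> real \<Rightarrow> 'a::euclidean_space set \<Rightarrow> ('a \<Rightarrow> real \<Rightarrow> real) \<Rightarrow> ('a \<Rightarrow> real) \<Rightarrow> bool" where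
  "subsolution s p \<Omega> f u \<longleftrightarrow>
     u \<in> W_tilde s p \<Omega> \<and> (AE x in lebesgue_on (- \<Omega>). u x \<le> 0) \<and>
     (\<forall>v\<in>W0_sp_nonneg s p \<Omega>. frac_p_laplacian s p u v \<le> (LINT x:\<Omega>|lebesgue. f x (u x) * v x))"

definition solution ::
    "real \<Rightarrow> real \<Rightarrow> 'a::euclidean_space set \<Rightarrow> ('a \<Rightarrow> real \<Rightarrow> real) \<Rightarrow> ('a \<Rightarrow> real) \<Rightarrow> bool" where
  "solution s p \<Omega> f u \<longleftrightarrow>
     u \<in> W0_sp s p \<Omega> \<and>
     (\<forall>v\<in>W0_sp s p \<Omega>. frac_p_laplacian s p u v = (LINT x:\<Omega>|lebesgue. f x (u x) * v x))"

definition sub_supersolution_pair ::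
    "real \<Rightarrow> real \<Rightarrow> 'a::euclidean_space set \<Rightarrow> ('a \<Rightarrow> real \<Rightarrow> real)
      \<Rightarrow> ('a \<Rightarrow> real) \<Rightarrow> ('a \<Rightarrow> real) \<Rightarrow> bool" where
  "sub_supersolution_pair s p \<Omega> f ul uu \<longleftrightarrow>
     subsolution s p \<Omega> f ul \<and> supersolution s p \<Omega> f uu \<and> (AE x in lebesgue_on \<Omega>. ul x \<le> uu x)"

definition solution_set ::
    "real \<Rightarrow> real \<Rightarrow> 'a::euclidean_space set \<Rightarrow> ('a \<Rightarrow> real \<Rightarrow> real)
      \<Rightarrow> ('a \<Rightarrow> real) \<Rightarrow> ('a \<Rightarrow> real) \<Rightarrow> ('a \<Rightarrow> real) set" where
  "solution_set s p \<Omega> f ul uu =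
     {u \<in> W0_sp s p \<Omega>. solution s p \<Omega> f u \<and> (AE x in lebesgue. ul x \<le> u x \<and> u x \<le> uu x)}"


section \<open>Hypotheses on the data\<close>

text \<open>
  Near every boundary point, in coordinates given by a unit vector \<open>e\<close> and the hyperplane
  orthogonal to it, the set is the strict epigraph of a function on the hyperplane with Lipschitz
  gradient. Only the values of \<open>\<gamma>\<close> on the hyperplane matter; a function given on the
  hyperplane is extended to the whole space by composing it with the orthogonal projection.
\<close>

definition C11_boundary :: "'a::euclidean_space set \<Rightarrow> bool" where
  "C11_boundary \<Omega> \<longleftrightarrow>
     (\<forall>x0\<in>frontier \<Omega>. \<exists>r>0. \<exists>e \<gamma> g L.
        norm e = 1 \<and> (\<forall>y. GDERIV \<gamma> y :> g y) \<and> L-lipschitz_on UNIV g \<and>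
        \<Omega> \<inter> ball x0 r = {x \<in> ball x0 r. \<gamma> (x - (x \<bullet> e) *\<^sub>R e) < x \<bullet> e})"

definition caratheodory :: "'a::euclidean_space set \<Rightarrow> ('a \<Rightarrow> real \<Rightarrow> real) \<Rightarrow> bool" where
  "caratheodory \<Omega> f \<longleftrightarrow>
     (\<forall>t. (\<lambda>x. f x t) \<in> borel_measurable (lebesgue_on \<Omega>)) \<and>
     (AE x in lebesgue_on \<Omega>. continuous_on UNIV (f x))"


section \<open>The normed space of classes of almost everywhere equal functions\<close>

definition ae_eq :: "(('a::euclidean_space \<Rightarrow> real) \<times> ('a \<Rightarrow> real)) set" where
  "ae_eq = {(u, v). u \<in> borel_measurable lebesgue \<and> v \<in> borel_measurable lebesgue \<and>
                    (AE x in lebesgue. u x = v x)}"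

text \<open>The distance \<open>[u - v]\<close>; it does not depend on the representatives (lemma \<open>W0_dist_eq\<close>).\<close>

definition W0_dist ::
    "real \<Rightarrow> real \<Rightarrow> ('a::euclidean_space \<Rightarrow> real) set \<Rightarrow> ('a \<Rightarrow> real) set \<Rightarrow> real" where
  "W0_dist s p A B = gagliardo_seminorm s p (\<lambda>x. (SOME u. u \<in> A) x - (SOME v. v \<in> B) x)"

definition W0_topology :: "real \<Rightarrow> real \<Rightarrow> 'a::euclidean_space set \<Rightarrow> ('a \<Rightarrow> real) set topology" where
  "W0_topology s p \<Omega> = Metric_space.mtopology (W0_sp s p \<Omega> // ae_eq) (W0_dist s p)"


section \<open>The space is a metric space\<close>

text \<open>
  \<open>Metric_space.mtopology\<close> is only meaningful on a metric space. We check that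
  \<open>W0_dist\<close> is a metric on the classes (lemma \<open>Metric_space_W0\<close>) and is computed by
  arbitrary representatives (lemma \<open>W0_dist_eq\<close>).
\<close>

lemma frac_measure_sets [measurable_cong, simp]:
  "sets (frac_measure s p) = sets (lebesgue \<Otimes>\<^sub>M lebesgue)"
  by (simp add: frac_measure_def)

lemma borel_id_lebesgue: "f \<in> M \<rightarrow>\<^sub>M lebesgue \<Longrightarrow> f \<in> M \<rightarrow>\<^sub>M borel"
  using measurable_comp[of f M lebesgue "\<lambda>x. x" borel] by (simp add: comp_def measurable_completion)

lemma kernel_measurable:
  "(\<lambda>(x::'a::euclidean_space, y). ennreal (norm (x - y) powr c))
     \<in> borel_measurable (lebesgue \<Otimes>\<^sub>M lebesgue)"
proof -
  have "fst \<in> (lebesgue \<Otimes>\<^sub>M lebesgue :: ('a \<times> 'a) measure) \<rightarrow>\<^sub>M borel"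
    and "snd \<in> (lebesgue \<Otimes>\<^sub>M lebesgue :: ('a \<times> 'a) measure) \<rightarrow>\<^sub>M borel"
    by (rule borel_id_lebesgue, rule measurable_fst, rule borel_id_lebesgue, rule measurable_snd)
  note [measurable] = this
  show ?thesis unfolding split_beta by measurable
qed

lemma sigma_finite_lebesgue: "sigma_finite_measure (lebesgue :: 'a::euclidean_space measure)"
proof
  let ?C = "range (\<lambda>n. cball (0 :: 'a) (real n))"
  show "\<exists>A. countable A \<and> A \<subseteq> sets lebesgue \<and> \<Union> A = space lebesgue \<and>
          (\<forall>a\<in>A. emeasure (lebesgue :: 'a measure) a \<noteq> \<infinity>)"
  proof (intro exI[of _ ?C] conjI ballI)
    show "\<Union> ?C = space lebesgue"
      using real_arch_simple by fastforce
    show "emeasure lebesgue a \<noteq> \<infinity>" if "a \<in> ?C" for a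
    proof -
      have "bounded a" using that by auto
      from emeasure_bounded_finite[OF this] show ?thesis
        using that by auto
    qed
  qed auto
qed

lemma AE_fst_snd:
  fixes P :: "'a::euclidean_space \<Rightarrow> bool"
  assumes "AE x in lebesgue. P x"
  shows "AE z in frac_measure s p. P (fst z) \<and> P (snd z)"
proof -
  interpret L: sigma_finite_measure "lebesgue :: 'a measure"
    by (rule sigma_finite_lebesgue)
  interpret P: pair_sigma_finite "lebesgue :: 'a measure" "lebesgue :: 'a measure" ..
  obtain N where N: "N \<in> null_sets (lebesgue :: 'a measure)" "{x. \<not> P x} \<subseteq> N"
    using assms by (auto simp: eventually_ae_filter)
  have "emeasure (lebesgue \<Otimes>\<^sub>M lebesgue) (N \<times> (UNIV :: 'a set)) = 0"
    using N by (subst L.emeasure_pair_measure_Times) auto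
  moreover have "emeasure (lebesgue \<Otimes>\<^sub>M lebesgue) ((UNIV :: 'a set) \<times> N) = 0"
    using N by (subst L.emeasure_pair_measure_Times) auto
  moreover have "N \<times> (UNIV :: 'a set) \<in> sets (lebesgue \<Otimes>\<^sub>M lebesgue)"
    "(UNIV :: 'a set) \<times> N \<in> sets (lebesgue \<Otimes>\<^sub>M lebesgue)"
    using N by auto
  ultimately have "N \<times> UNIV \<union> UNIV \<times> N \<in> null_sets (lebesgue \<Otimes>\<^sub>M lebesgue :: ('a \<times> 'a) measure)"
    by (intro null_sets.Un) (auto simp: null_sets_def)
  then have "AE z in lebesgue \<Otimes>\<^sub>M lebesgue. P (fst z) \<and> P (snd z)"
    by (rule AE_I'[OF _ ]) (use N in auto)
  then show ?thesis
    unfolding frac_measure_def by (subst AE_density) (auto simp: kernel_measurable)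
qed

lemma powr_add_le_weighted:
  fixes A B x y p :: real
  assumes "1 \<le> p" "0 < A" "0 < B" "0 \<le> x" "0 \<le> y"
  shows "(x + y) powr p \<le> (A + B) powr p * (A / (A + B) * (x powr p / A powr p) + B / (A + B) * (y powr p / B powr p))"
proof -
  define t where "t = B / (A + B)"
  have t: "0 < t" "t < 1" "1 - t = A / (A + B)"
    using assms by (auto simp: t_def field_simps)
  have sm: "(c * w) powr p \<le> c * w powr p" if "0 < c" "c < 1" "0 \<le> w" for c w
  proof -
    have "c powr p \<le> c powr 1" using that assms(1) by (intro powr_mono') auto
    then show ?thesis using that by (simp add: powr_mult mult_right_mono)
  qed
  have key: "((1 - t) * a + t * b) powr p \<le> (1 - t) * a powr p + t * b powr p"
    if ab: "0 \<le> a" "0 \<le> b" for a b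
  proof -
    consider "a = 0" | "b = 0" | "0 < a" "0 < b" using ab by linarith
    then show ?thesis
    proof cases
      case 1
      then show ?thesis using sm[of t b] t that assms by simp
    next
      case 2
      then show ?thesis using sm[of "1 - t" a] t that assms by simp
    next
      case 3
      then show ?thesis using convex_onD[OF powr_convex[OF assms(1)], of t a b] t by simp
    qed
  qed
  have "x + y = (A + B) * ((1 - t) * (x / A) + t * (y / B))"
  proof -
    have "A + B \<noteq> 0" using assms by simp
    then have "(A + B) * (A / (A + B) * (x / A)) = x" "(A + B) * (B / (A + B) * (y / B)) = y"
      using assms by simp_all
    then show ?thesis unfolding t(3) unfolding t_def by (simp only: distrib_left)
  qed
  then have "(x + y) powr p = (A + B) powr p * ((1 - t) * (x / A) + t * (y / B)) powr p"
    using assms t by (simp add: powr_mult)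
  also have "\<dots> \<le> (A + B) powr p * ((1 - t) * (x / A) powr p + t * (y / B) powr p)"
    by (intro mult_left_mono key) (use assms in auto)
  finally show ?thesis
    unfolding t(3) unfolding t_def using assms by (simp add: powr_divide)
qed

lemma minkowski:
  fixes a b :: "'b \<Rightarrow> real"
  assumes p: "1 \<le> p"
    and [measurable]: "a \<in> borel_measurable M" "b \<in> borel_measurable M"
    and ia: "integrable M (\<lambda>z. \<bar>a z\<bar> powr p)" and ib: "integrable M (\<lambda>z. \<bar>b z\<bar> powr p)"
  shows "integrable M (\<lambda>z. \<bar>a z + b z\<bar> powr p)" (is ?I)
    and "(\<integral>z. \<bar>a z + b z\<bar> powr p \<partial>M) powr (1 / p)
           \<le> (\<integral>z. \<bar>a z\<bar> powr p \<partial>M) powr (1 / p) + (\<integral>z. \<bar>b z\<bar> powr p \<partial>M) powr (1 / p)" (is "?l \<le> ?A + ?B")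
proof -
  let ?f = "\<lambda>A B z. (A + B) powr p * (A / (A + B) * (\<bar>a z\<bar> powr p / A powr p) + B / (A + B) * (\<bar>b z\<bar> powr p / B powr p))"
  have pw: "\<bar>a z + b z\<bar> powr p \<le> ?f A B z" if "0 < A" "0 < B" for A B z
  proof -
    have "\<bar>a z + b z\<bar> powr p \<le> (\<bar>a z\<bar> + \<bar>b z\<bar>) powr p"
      using p by (intro powr_mono2) auto
    also have "\<dots> \<le> ?f A B z" by (rule powr_add_le_weighted) (use p that in auto)
    finally show ?thesis .
  qed
  have fi: "integrable M (?f A B)" for A B using ia ib by simp
  show I: ?I
  proof (rule Bochner_Integration.integrable_bound[OF fi[of 1 1]])
    show "AE z in M. norm (\<bar>a z + b z\<bar> powr p) \<le> norm (?f 1 1 z)"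
      using pw[of 1 1] by (intro AE_I2) fastforce
  qed measurable
  have main: "?l \<le> A + B" if A: "?A < A" and B: "?B < B" for A B
  proof -
    have pos: "0 < A" "0 < B" using A B by (meson le_less_trans powr_ge_zero)+
    have up: "J \<le> C powr p" if "J powr (1/p) < C" "0 \<le> J" for J C :: real
    proof -
      have "(J powr (1/p)) powr p \<le> C powr p" using that p by (intro powr_mono2) auto
      then show ?thesis using p that by (simp add: powr_powr)
    qed
    have ja: "(\<integral>z. \<bar>a z\<bar> powr p \<partial>M) / A powr p \<le> 1" using up[OF A] pos by simp
    have jb: "(\<integral>z. \<bar>b z\<bar> powr p \<partial>M) / B powr p \<le> 1" using up[OF B] pos by simp
    have "(\<integral>z. \<bar>a z + b z\<bar> powr p \<partial>M) \<le> (\<integral>z. ?f A B z \<partial>M)"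
      using I fi pw[OF pos] by (intro integral_mono) auto
    also have "\<dots> = (A + B) powr p * (A / (A + B) * ((\<integral>z. \<bar>a z\<bar> powr p \<partial>M) / A powr p)
                      + B / (A + B) * ((\<integral>z. \<bar>b z\<bar> powr p \<partial>M) / B powr p))"
      using ia ib by simp
    also have "\<dots> \<le> (A + B) powr p * (A / (A + B) * 1 + B / (A + B) * 1)"
      using pos ja jb by (intro mult_left_mono add_mono) auto
    also have "\<dots> = (A + B) powr p" using pos by (simp add: field_simps flip: add_divide_distrib)
    finally have "?l \<le> ((A + B) powr p) powr (1 / p)"
      using p by (intro powr_mono2) auto
    then show ?thesis using p pos by (simp add: powr_powr)
  qed
  show "?l \<le> ?A + ?B"
  proof (rule field_le_epsilon)
    fix e :: real assume "0 < e"
    then show "?l \<le> ?A + ?B + e" using main[of "?A + e/2" "?B + e/2"] by simp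
  qed
qed

lemma gagliardo_seminorm_integral:
  fixes u :: "'a::euclidean_space \<Rightarrow> real"
  assumes "u \<in> borel_measurable lebesgue"
  shows "(\<lambda>z. u (fst z) - u (snd z)) \<in> borel_measurable (frac_measure s p)"
    and "gagliardo_int s p UNIV u < \<infinity> \<longleftrightarrow>
           integrable (frac_measure s p) (\<lambda>z. \<bar>u (fst z) - u (snd z)\<bar> powr p)"
    and "gagliardo_seminorm s p u =
           (\<integral>z. \<bar>u (fst z) - u (snd z)\<bar> powr p \<partial>frac_measure s p) powr (1 / p)"
proof -
  have "(\<lambda>z. u (fst z)) \<in> borel_measurable (lebesgue \<Otimes>\<^sub>M lebesgue)"
       "(\<lambda>z. u (snd z)) \<in> borel_measurable (lebesgue \<Otimes>\<^sub>M lebesgue)"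
    using assms by (auto intro: measurable_compose[OF measurable_fst] measurable_compose[OF measurable_snd])
  then show m: "(\<lambda>z. u (fst z) - u (snd z)) \<in> borel_measurable (frac_measure s p)"
    unfolding measurable_cong_sets[OF frac_measure_sets refl] by (rule borel_measurable_diff)
  note [measurable] = m
  show "gagliardo_int s p UNIV u < \<infinity> \<longleftrightarrow>
           integrable (frac_measure s p) (\<lambda>z. \<bar>u (fst z) - u (snd z)\<bar> powr p)"
    by (simp add: gagliardo_int_def integrable_iff_bounded)
  show "gagliardo_seminorm s p u =
           (\<integral>z. \<bar>u (fst z) - u (snd z)\<bar> powr p \<partial>frac_measure s p) powr (1 / p)"
    unfolding gagliardo_seminorm_def gagliardo_int_def
    by (subst integral_eq_nn_integral) auto
qed

lemma gagliardo_seminorm_cong: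
  assumes "AE x in lebesgue. u x = v x"
  shows "gagliardo_seminorm s p u = gagliardo_seminorm s p v"
proof -
  have "gagliardo_int s p UNIV u = gagliardo_int s p UNIV v"
    unfolding gagliardo_int_def
    by (rule nn_integral_cong_AE) (use AE_fst_snd[OF assms] in eventually_elim, simp)
  then show ?thesis by (simp add: gagliardo_seminorm_def)
qed

lemma gagliardo_seminorm_eq_0D:
  fixes u :: "'a::euclidean_space \<Rightarrow> real"
  assumes p: "1 \<le> p" and \<Omega>: "open \<Omega>" "bounded \<Omega>"
    and m: "u \<in> borel_measurable lebesgue" and z: "AE x in lebesgue_on (- \<Omega>). u x = 0"
    and fin: "gagliardo_int s p UNIV u < \<infinity>"
    and 0: "gagliardo_seminorm s p u = 0"
  shows "AE x in lebesgue. u x = 0"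
proof -
  interpret L: sigma_finite_measure "lebesgue :: 'a measure"
    by (rule sigma_finite_lebesgue)
  interpret P: pair_sigma_finite "lebesgue :: 'a measure" "lebesgue :: 'a measure" ..
  note g = gagliardo_seminorm_integral[OF m, where s=s and p=p]
  have "(\<integral>z. \<bar>u (fst z) - u (snd z)\<bar> powr p \<partial>frac_measure s p) = 0"
    using 0 unfolding g(3) by simp
  then have "AE z in frac_measure s p. \<bar>u (fst z) - u (snd z)\<bar> powr p = 0"
    using g(2) fin by (subst (asm) integral_nonneg_eq_0_iff_AE) auto
  then have "AE z in lebesgue \<Otimes>\<^sub>M lebesgue. u (fst z) = u (snd z)"
    unfolding frac_measure_def
    by (subst (asm) AE_density) (auto simp: kernel_measurable elim!: eventually_mono)
  then have ae: "AE x in lebesgue. AE y in lebesgue. u x = u y"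
    using P.AE_pair by fastforce
  have z': "AE x in lebesgue. x \<in> - \<Omega> \<longrightarrow> u x = 0"
    using z \<Omega> by (subst (asm) AE_restrict_space_iff) auto
  have "\<exists>x\<in>- \<Omega>. u x = 0 \<and> (AE y in lebesgue. u x = u y)"
  proof (rule ccontr)
    assume "\<not> ?thesis"
    then have "AE x in lebesgue. x \<in> \<Omega>"
      using ae z' by (auto elim!: eventually_elim2)
    then have "emeasure lebesgue \<Omega> = emeasure lebesgue (UNIV :: 'a set)"
      using \<Omega> by (intro emeasure_eq_AE) auto
    moreover have "emeasure lebesgue \<Omega> < \<infinity>"
      using emeasure_bounded_finite[OF \<Omega>(2)] \<Omega>(1) by simp
    ultimately show False by simp
  qed
  then obtain x where "u x = 0" "AE y in lebesgue. u x = u y" by blast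
  then show ?thesis by simp
qed

lemma equiv_ae_eq: "equiv (borel_measurable lebesgue) ae_eq"
  by (rule equivI) (auto simp: ae_eq_def refl_on_def sym_def trans_def elim: eventually_mono eventually_elim2)

lemma W0_dist_eq:
  assumes "u \<in> W0_sp s p \<Omega>" "v \<in> W0_sp s p \<Omega>"
  shows "W0_dist s p (ae_eq `` {u}) (ae_eq `` {v}) = gagliardo_seminorm s p (\<lambda>x. u x - v x)"
proof -
  have *: "AE x in lebesgue. (SOME w. w \<in> ae_eq `` {u}) x = u x" if "u \<in> W0_sp s p \<Omega>" for u
  proof -
    have "u \<in> ae_eq `` {u}"
      using that by (simp add: ae_eq_def W0_sp_def W_sp_def lebesgue_on_UNIV_eq)
    then have "(SOME w. w \<in> ae_eq `` {u}) \<in> ae_eq `` {u}" by (rule someI[where P = "\<lambda>w. w \<in> ae_eq `` {u}"])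
    then show ?thesis by (auto simp: ae_eq_def elim: eventually_mono)
  qed
  show ?thesis unfolding W0_dist_def
    by (rule gagliardo_seminorm_cong) (use *[OF assms(1)] *[OF assms(2)] in eventually_elim, simp)
qed

lemma Metric_space_W0:
  assumes p: "1 \<le> p" and \<Omega>: "open \<Omega>" "bounded \<Omega>"
  shows "Metric_space (W0_sp s p \<Omega> // ae_eq) (W0_dist s p)"
proof
  let ?I = "\<lambda>u z. \<bar>u (fst z) - u (snd z)\<bar> powr p"
  have W: "u \<in> borel_measurable lebesgue" "gagliardo_int s p UNIV u < \<infinity>"
    "AE x in lebesgue. x \<in> - \<Omega> \<longrightarrow> u x = 0" "(\<lambda>x. - u x) \<in> borel_measurable lebesgue"
    "gagliardo_int s p UNIV (\<lambda>x. - u x) < \<infinity>"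
    if "u \<in> W0_sp s p \<Omega>" for u
    using that \<Omega> by (auto simp: W0_sp_def W_sp_def lebesgue_on_UNIV_eq AE_restrict_space_iff gagliardo_int_def abs_minus_commute)
  have add: "gagliardo_int s p UNIV (\<lambda>x. u x + v x) < \<infinity>"
    "gagliardo_seminorm s p (\<lambda>x. u x + v x) \<le> gagliardo_seminorm s p u + gagliardo_seminorm s p v"
    if u: "u \<in> borel_measurable lebesgue" "gagliardo_int s p UNIV u < \<infinity>"
      and v: "v \<in> borel_measurable lebesgue" "gagliardo_int s p UNIV v < \<infinity>" for u v
  proof -
    have uv: "(\<lambda>x. u x + v x) \<in> borel_measurable lebesgue" using u v by simp
    note gu = gagliardo_seminorm_integral[OF u(1), where s=s and p=p]
    note gv = gagliardo_seminorm_integral[OF v(1), where s=s and p=p]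
    note guv = gagliardo_seminorm_integral[OF uv, where s=s and p=p]
    note mk = minkowski[OF p gu(1) gv(1)] 
    have e: "u a + v a - (u b + v b) = (u a - u b) + (v a - v b)" for a b by simp
    show "gagliardo_int s p UNIV (\<lambda>x. u x + v x) < \<infinity>"
      using mk(1) gu(2) gv(2) u v unfolding guv(2) e by blast
    show "gagliardo_seminorm s p (\<lambda>x. u x + v x) \<le> gagliardo_seminorm s p u + gagliardo_seminorm s p v"
      using mk(2) gu(2) gv(2) u v unfolding gu(3) gv(3) guv(3) e by blast
  qed
  have dif: "(\<lambda>x. u x - v x) \<in> borel_measurable lebesgue" "gagliardo_int s p UNIV (\<lambda>x. u x - v x) < \<infinity>"
    if "u \<in> W0_sp s p \<Omega>" "v \<in> W0_sp s p \<Omega>" for u v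
    using add(1)[of u "\<lambda>x. - v x"] W[OF that(1)] W[OF that(2)] by auto
  show "0 \<le> W0_dist s p A B" for A B :: "('a \<Rightarrow> real) set"
    by (simp add: W0_dist_def gagliardo_seminorm_def)
  show "W0_dist s p A B = W0_dist s p B A" for A B :: "('a \<Rightarrow> real) set"
  proof -
    have "\<bar>a - b - (c - d)\<bar> = \<bar>b - a - (d - c)\<bar>" for a b c d :: real by simp
    then show ?thesis
      unfolding W0_dist_def gagliardo_seminorm_def gagliardo_int_def by metis
  qed
  show "W0_dist s p A B = 0 \<longleftrightarrow> A = B"
    if A: "A \<in> W0_sp s p \<Omega> // ae_eq" and B: "B \<in> W0_sp s p \<Omega> // ae_eq" for A B
  proof
    assume "A = B"
    then show "W0_dist s p A B = 0"
      using p by (simp add: W0_dist_def gagliardo_seminorm_def gagliardo_int_def)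
  next
    assume 0: "W0_dist s p A B = 0"
    obtain u where u: "u \<in> W0_sp s p \<Omega>" "A = ae_eq `` {u}" using A by (rule quotientE)
    obtain v where v: "v \<in> W0_sp s p \<Omega>" "B = ae_eq `` {v}" using B by (rule quotientE)
    have "AE x in lebesgue_on (- \<Omega>). u x - v x = 0"
      using W(3)[OF u(1)] W(3)[OF v(1)] \<Omega>
      by (subst AE_restrict_space_iff) (auto elim: eventually_elim2)
    then have "AE x in lebesgue. u x - v x = 0"
      using 0 dif[OF u(1) v(1)] W0_dist_eq[OF u(1) v(1)] u(2) v(2)
      by (intro gagliardo_seminorm_eq_0D[OF p \<Omega>, of _ s]) auto
    then have "(u, v) \<in> ae_eq"
      using W(1)[OF u(1)] W(1)[OF v(1)] by (simp add: ae_eq_def)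
    then show "A = B" unfolding u v by (rule equiv_class_eq[OF equiv_ae_eq])
  qed
  show "W0_dist s p A C \<le> W0_dist s p A B + W0_dist s p B C"
    if A: "A \<in> W0_sp s p \<Omega> // ae_eq" and B: "B \<in> W0_sp s p \<Omega> // ae_eq"
      and C: "C \<in> W0_sp s p \<Omega> // ae_eq" for A B C
  proof -
    obtain u where u: "u \<in> W0_sp s p \<Omega>" "A = ae_eq `` {u}" using A by (rule quotientE)
    obtain v where v: "v \<in> W0_sp s p \<Omega>" "B = ae_eq `` {v}" using B by (rule quotientE)
    obtain w where w: "w \<in> W0_sp s p \<Omega>" "C = ae_eq `` {w}" using C by (rule quotientE)
    show ?thesis
      using add(2)[OF dif[OF u(1) v(1)] dif[OF v(1) w(1)]]
      by (simp add: u(2) v(2) w(2) W0_dist_eq[OF u(1) v(1)] W0_dist_eq[OF v(1) w(1)] W0_dist_eq[OF u(1) w(1)])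
  qed
qed

end

theory Submission
  imports Defs "HOL-Complex_Analysis.Great_Picard"
begin

text \<open>
  The operator is strongly monotone for \<open>p \<ge> 2\<close>: up to a constant, \<open>[u - v]^p\<close> is at most the pairing
  of the difference of the operators at \<open>u\<close> and \<open>v\<close> with \<open>u - v\<close>. For two solutions that pairing equals
  \<open>\<integral> (f(x,u) - f(x,v)) (u - v)\<close>. Every solution between \<open>ul\<close> and \<open>uu\<close> is bounded by the fixed
  function \<open>g = |ul| + |uu|\<close> on \<open>\<Omega>\<close> and vanishes outside, so by the growth condition the pairing is at most
  a constant times \<open>\<integral> (1 + g^(q-1)) |u - v|\<close>. As soon as \<open>g\<close> lies in \<open>L^q(\<Omega>)\<close>, dominated convergence
  turns almost everywhere convergence of solutions into Cauchy convergence in the norm of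
  \<open>W_0^{s,p}(\<Omega>)\<close>; Fatou's lemma identifies the norm limit with the pointwise one, and the
  equation passes to the limit.

  Two facts about fractional Sobolev functions feed this argument.

  The first (\<open>W_sp_Lq_integrable\<close>) puts \<open>g\<close> and the test functions in \<open>L^q(\<Omega>)\<close> for
  \<open>q < p_s^*\<close>. It is a bootstrap: if \<open>u\<close> is in \<open>L^r\<close> near \<open>x\<close>, then by
  Chebyshev's inequality \<open>|u| \<le> |u(x)|/2\<close> on half of a ball around \<open>x\<close> of radius comparable to
  \<open>|u(x)|^(-r/N)\<close>, and the Gagliardo energy density at \<open>x\<close> is at least a multiple of
  \<open>|u(x)|^(p + r ps/N)\<close>. So \<open>u\<close> is in \<open>L^(p + r ps/N)\<close> on every slightly smaller set, and
  the iterates of \<open>r \<mapsto> p + r ps/N\<close> starting at \<open>p\<close> increase to the fixed point \<open>p_s^*\<close>.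

  The second (\<open>rellich_dominated\<close>) extracts an almost everywhere convergent subsequence from a
  sequence with bounded seminorms and an integrable majorant that lives on a set of finite measure. Averages over the cells of
  countably many cubic grids converge along a diagonal subsequence, and the energy bounds the \<open>L^1\<close> distance
  between a function and its cell averages by a quantity that vanishes with the mesh.

  The seminorms of solutions are bounded because testing the equation with the solution itself
  gives \<open>[u]^p = \<integral> f(x,u) u\<close>.
\<close>

section \<open>Power inequalities\<close>

lemma powr_superadditive:
  fixes x y m :: real
  assumes "1 \<le> m" "0 \<le> x" "0 \<le> y"
  shows "x powr m + y powr m \<le> (x + y) powr m"
proof -
  have eq: "w powr m = w * w powr (m - 1)" if "0 \<le> w" for w :: real
    using that by (cases "w = 0") (simp_all add: powr_diff)
  have "x powr m + y powr m \<le> x * (x + y) powr (m - 1) + y * (x + y) powr (m - 1)"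
    using assms by (auto simp: eq intro!: add_mono mult_left_mono powr_mono2)
  also have "\<dots> = (x + y) powr m" using assms by (simp add: eq distrib_right)
  finally show ?thesis .
qed

lemma powr_young:
  fixes x y r :: real
  assumes "1 \<le> r" "0 \<le> x" "0 \<le> y"
  shows "x powr (r - 1) * y \<le> x powr r + y powr r"
proof -
  have eq: "w powr (r - 1) * w = w powr r" if "0 \<le> w" for w :: real
    using that by (cases "w = 0") (simp_all add: powr_diff)
  have "x powr (r - 1) * y \<le> max x y powr (r - 1) * max x y"
    using assms by (intro mult_mono powr_mono2) auto
  also have "\<dots> = max x y powr r" using assms by (intro eq) auto
  also have "\<dots> \<le> x powr r + y powr r" by (auto simp: max_def)
  finally show ?thesis .
qed

lemma powr_add_le:
  fixes x y r :: real
  assumes "0 \<le> r" "0 \<le> x" "0 \<le> y"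
  shows "(x + y) powr r \<le> 2 powr r * (x powr r + y powr r)"
proof -
  have "(x + y) powr r \<le> (2 * max x y) powr r"
    using assms by (intro powr_mono2) auto
  also have "\<dots> = 2 powr r * max x y powr r" using assms by (simp add: powr_mult)
  also have "\<dots> \<le> 2 powr r * (x powr r + y powr r)"
    by (intro mult_left_mono) (auto simp: max_def)
  finally show ?thesis .
qed

text \<open>
  By oddness it suffices to take \<open>b \<le> a\<close>. For arguments of the same sign the claim is superadditivity of
  \<open>t^(p-1)\<close>, even with constant 1; for opposite signs it is the comparison of \<open>(x + y)^(p-1)\<close> with
  \<open>x^(p-1) + y^(p-1)\<close>, which costs the factor \<open>2^(1-p)\<close>.
\<close>

lemma strongly_monotone_powr:
  fixes a b p :: real
  assumes p: "2 \<le> p"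
  shows "2 powr (1 - p) * \<bar>a - b\<bar> powr p
           \<le> (\<bar>a\<bar> powr (p - 2) * a - \<bar>b\<bar> powr (p - 2) * b) * (a - b)"
proof -
  let ?\<phi> = "\<lambda>a::real. \<bar>a\<bar> powr (p - 2) * a"
  have eq: "\<bar>w\<bar> powr (p - 2) * w = w powr (p - 1)" if "0 \<le> w" for w :: real
    using that by (cases "w = 0") (simp_all add: powr_diff power2_eq_square)
  have eq': "w powr (p - 1) * w = w powr p" if "0 \<le> w" for w :: real
    using that by (cases "w = 0") (simp_all add: powr_diff)
  have odd: "?\<phi> (- a) = - ?\<phi> a" for a by simp
  have same: "(a - b) powr (p - 1) \<le> ?\<phi> a - ?\<phi> b" if "0 \<le> b" "b \<le> a" for a b
    using powr_superadditive[of "p - 1" "a - b" b] that p eq[of a] eq[of b] by simp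
  have le1: "2 powr (1 - p) \<le> (1::real)" using p powr_mono[of "1 - p" 0 2] by simp
  have main: "2 powr (1 - p) * (a - b) powr (p - 1) \<le> ?\<phi> a - ?\<phi> b" if "b \<le> a" for a b
  proof -
    consider "0 \<le> b" | "a \<le> 0" | "b < 0" "0 < a" using that by linarith
    then show ?thesis
    proof cases
      case 1
      then show ?thesis using same[of b a] that le1
        by (smt (verit) mult_left_le_one_le powr_ge_zero)
    next
      case 2
      then show ?thesis using same[of "-a" "-b"] that le1 odd[of a] odd[of b]
        by (smt (verit) mult_left_le_one_le powr_ge_zero)
    next
      case 3
      have "(a + - b) powr (p - 1) \<le> 2 powr (p - 1) * (a powr (p - 1) + (- b) powr (p - 1))"
        using 3 p by (intro powr_add_le) auto
      then have "2 powr (1 - p) * (a - b) powr (p - 1)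
          \<le> 2 powr (1 - p) * (2 powr (p - 1) * (a powr (p - 1) + (- b) powr (p - 1)))"
        by (intro mult_left_mono) auto
      also have "\<dots> = a powr (p - 1) + (- b) powr (p - 1)"
        by (simp add: mult.assoc[symmetric] powr_add[symmetric])
      also have "\<dots> = ?\<phi> a - ?\<phi> b" using 3 eq[of a] eq[of "- b"] by simp
      finally show ?thesis .
    qed
  qed
  have *: "2 powr (1 - p) * \<bar>a - b\<bar> powr p \<le> (?\<phi> a - ?\<phi> b) * (a - b)" if "b \<le> a" for a b
    using mult_right_mono[OF main[OF that], of "a - b"] that by (simp add: mult.assoc eq')
  show ?thesis
    using *[of a b] *[of b a] by (cases "b \<le> a") (auto simp: abs_minus_commute algebra_simps)
qed

text \<open>
  This replaces Hoelder's inequality when an \<open>L^1\<close> quantity on a set of finite measure is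
  controlled by a \<open>p\<close>-energy: the first term is small by the choice of \<open>\<delta>\<close>, the second one
  carries the energy.
\<close>

lemma abs_le_young:
  fixes a \<delta> p :: real
  assumes "0 < \<delta>" "1 \<le> p" "0 \<le> a"
  shows "a \<le> \<delta> + \<delta> powr (1 - p) * a powr p"
proof (cases "a \<le> \<delta>")
  case True
  then show ?thesis by (simp add: add_increasing2)
next
  case False
  then have "a = a powr (1 - p) * a powr p"
    using assms by (simp flip: powr_add)
  also have "\<dots> \<le> \<delta> powr (1 - p) * a powr p"
    using False assms by (intro mult_right_mono powr_mono2') auto
  finally show ?thesis using assms by simp
qed

text \<open>
  At \<open>0\<close> the factor \<open>|a| powr (p - 2)\<close> need not be continuous (for \<open>p = 2\<close> it is the
  indicator of \<open>a \<noteq> 0\<close>), so the product is estimated as a whole by \<open>|a| powr (p - 1)\<close>.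
\<close>

lemma isCont_signed_powr:
  fixes p :: real
  assumes "1 < p"
  shows "isCont (\<lambda>a::real. \<bar>a\<bar> powr (p - 2) * a) a"
proof (cases "a = 0")
  case False
  then show ?thesis by (intro continuous_intros) auto
next
  case True
  have "((\<lambda>a::real. \<bar>a\<bar> powr (p - 1)) \<longlongrightarrow> \<bar>0\<bar> powr (p - 1)) (at 0)"
    using assms by (intro tendsto_powr2 tendsto_rabs tendsto_const tendsto_ident_at) auto
  then have "((\<lambda>a::real. \<bar>a\<bar> powr (p - 1)) \<longlongrightarrow> 0) (at 0)" by simp
  then have "((\<lambda>a::real. \<bar>a\<bar> powr (p - 2) * a) \<longlongrightarrow> 0) (at 0)"
  proof (rule tendsto_0_le[where K = 1])
    have "\<bar>x\<bar> powr (p - 2) * \<bar>x\<bar> = \<bar>x\<bar> powr (p - 1)" for x :: real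
      using powr_mult_base[of "\<bar>x\<bar>" "p - 2"] by (simp add: algebra_simps)
    then show "\<forall>\<^sub>F x in at 0. norm (\<bar>x\<bar> powr (p - 2) * x) \<le> norm (\<bar>x\<bar> powr (p - 1)) * 1"
      by (simp add: abs_mult)
  qed
  then show ?thesis using True by (simp add: isCont_def)
qed

lemma p_laplacian_integrand_bound:
  fixes a b p :: real
  assumes "1 \<le> p"
  shows "\<bar>\<bar>a\<bar> powr (p - 2) * a * b\<bar> \<le> \<bar>a\<bar> powr p + \<bar>b\<bar> powr p"
proof -
  have "\<bar>a\<bar> powr (p - 2) * \<bar>a\<bar> = \<bar>a\<bar> powr (p - 1)"
    using powr_mult_base[of "\<bar>a\<bar>" "p - 2"] by (simp add: algebra_simps)
  then have "\<bar>\<bar>a\<bar> powr (p - 2) * a * b\<bar> = \<bar>a\<bar> powr (p - 1) * \<bar>b\<bar>" by (simp add: abs_mult)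
  also have "\<dots> \<le> \<bar>a\<bar> powr p + \<bar>b\<bar> powr p" using assms by (intro powr_young) auto
  finally show ?thesis .
qed

section \<open>The Gagliardo energy and its density\<close>

text \<open>
  The inner integral of \<open>gagliardo_int s p U u\<close>, with the kernel written out.
\<close>

definition frac_energy_density ::
    "real \<Rightarrow> real \<Rightarrow> 'a::euclidean_space set \<Rightarrow> ('a \<Rightarrow> real) \<Rightarrow> 'a \<Rightarrow> ennreal" where
  "frac_energy_density s p U u x =
     (\<integral>\<^sup>+y\<in>U. ennreal (\<bar>u x - u y\<bar> powr p * norm (x - y) powr (- (real DIM('a) + p * s))) \<partial>lebesgue)"

lemma difference_quotient_measurable:
  fixes u :: "'a::euclidean_space \<Rightarrow> real"
  assumes "u \<in> borel_measurable lebesgue"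
  shows "(\<lambda>(x, y). ennreal (\<bar>u x - u y\<bar> powr p * norm (x - y) powr c))
           \<in> borel_measurable (lebesgue \<Otimes>\<^sub>M lebesgue)"
proof -
  have [measurable]: "(\<lambda>z. u (fst z) - u (snd z)) \<in> borel_measurable (lebesgue \<Otimes>\<^sub>M lebesgue)"
    using gagliardo_seminorm_integral(1)[OF assms] by (simp cong: measurable_cong_sets)
  have "(\<lambda>z. ennreal (\<bar>u (fst z) - u (snd z)\<bar> powr p) * (case z of (x, y) \<Rightarrow> ennreal (norm (x - y) powr c)))
           \<in> borel_measurable (lebesgue \<Otimes>\<^sub>M lebesgue)"
    by (intro borel_measurable_times_ennreal kernel_measurable) measurable
  then show ?thesis by (simp add: split_beta ennreal_mult)
qed

text \<open>
  Tonelli's theorem, after the kernel has moved from the measure into the integrand.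
\<close>

lemma gagliardo_int_eq_energy:
  fixes u :: "'a::euclidean_space \<Rightarrow> real"
  assumes u: "u \<in> borel_measurable lebesgue" and U: "U \<in> sets lebesgue"
  shows "frac_energy_density s p U u \<in> borel_measurable lebesgue"
    and "gagliardo_int s p U u = (\<integral>\<^sup>+x\<in>U. frac_energy_density s p U u x \<partial>lebesgue)"
proof -
  interpret L: sigma_finite_measure "lebesgue :: 'a measure"
    by (rule sigma_finite_lebesgue)
  let ?c = "- (real DIM('a) + p * s)"
  let ?D = "\<lambda>z::'a\<times>'a. case z of (x, y) \<Rightarrow> ennreal (\<bar>u x - u y\<bar> powr p * norm (x - y) powr ?c)"
  have [measurable]: "?D \<in> borel_measurable (lebesgue \<Otimes>\<^sub>M lebesgue)"
    by (rule difference_quotient_measurable[OF u])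
  have [measurable]: "U \<times> U \<in> sets (lebesgue \<Otimes>\<^sub>M lebesgue)" "UNIV \<times> U \<in> sets (lebesgue \<Otimes>\<^sub>M (lebesgue :: 'a measure))"
    using U by auto
  have "(\<lambda>x. \<integral>\<^sup>+y. ?D (x, y) * indicator (UNIV \<times> U) (x, y) \<partial>lebesgue) \<in> borel_measurable lebesgue"
    by (rule L.borel_measurable_nn_integral_fst) measurable
  then show "frac_energy_density s p U u \<in> borel_measurable lebesgue"
    unfolding frac_energy_density_def[abs_def] by (simp add: indicator_times)
  have [measurable]: "(\<lambda>z. u (fst z) - u (snd z)) \<in> borel_measurable (lebesgue \<Otimes>\<^sub>M lebesgue)"
    using gagliardo_seminorm_integral(1)[OF u] by (simp cong: measurable_cong_sets)
  have "gagliardo_int s p U u = (\<integral>\<^sup>+z. ?D z * indicator (U \<times> U) z \<partial>(lebesgue \<Otimes>\<^sub>M lebesgue))"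
    unfolding gagliardo_int_def frac_measure_def
    by (subst nn_integral_density)
       (auto simp: kernel_measurable split_beta ennreal_mult mult_ac intro!: nn_integral_cong)
  also have "\<dots> = (\<integral>\<^sup>+x. \<integral>\<^sup>+y. ?D (x, y) * indicator (U \<times> U) (x, y) \<partial>lebesgue \<partial>lebesgue)"
    by (rule L.nn_integral_fst[symmetric]) measurable
  also have "\<dots> = (\<integral>\<^sup>+x\<in>U. frac_energy_density s p U u x \<partial>lebesgue)"
    by (rule nn_integral_cong) (auto simp: frac_energy_density_def indicator_times split: split_indicator)
  finally show "gagliardo_int s p U u = (\<integral>\<^sup>+x\<in>U. frac_energy_density s p U u x \<partial>lebesgue)" .
qed

lemma gagliardo_int_diff_le:
  fixes u v :: "'a::euclidean_space \<Rightarrow> real"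
  assumes p: "0 \<le> p" and u: "u \<in> borel_measurable lebesgue" and v: "v \<in> borel_measurable lebesgue"
  shows "gagliardo_int s p UNIV (\<lambda>x. u x - v x)
           \<le> ennreal (2 powr p) * (gagliardo_int s p UNIV u + gagliardo_int s p UNIV v)"
proof -
  let ?M = "frac_measure s p :: ('a \<times> 'a) measure"
  let ?D = "\<lambda>u z. \<bar>u (fst z) - u (snd z)\<bar> powr p"
  note [measurable] = gagliardo_seminorm_integral(1)[OF u, of s p] gagliardo_seminorm_integral(1)[OF v, of s p]
  have le: "?D (\<lambda>x. u x - v x) z \<le> 2 powr p * (?D u z + ?D v z)" for z :: "'a \<times> 'a"
  proof -
    have "?D (\<lambda>x. u x - v x) z \<le> (\<bar>u (fst z) - u (snd z)\<bar> + \<bar>v (fst z) - v (snd z)\<bar>) powr p"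
      using p by (intro powr_mono2) auto
    also have "\<dots> \<le> 2 powr p * (?D u z + ?D v z)" using p by (intro powr_add_le) auto
    finally show ?thesis .
  qed
  have "gagliardo_int s p UNIV (\<lambda>x. u x - v x) \<le> (\<integral>\<^sup>+z. ennreal (2 powr p) * (ennreal (?D u z) + ennreal (?D v z)) \<partial>?M)"
    unfolding gagliardo_int_def
    by (intro nn_integral_mono) (use le in \<open>simp add: ennreal_leI flip: ennreal_mult ennreal_plus\<close>)
  also have "\<dots> = ennreal (2 powr p) * ((\<integral>\<^sup>+z. ennreal (?D u z) \<partial>?M) + (\<integral>\<^sup>+z. ennreal (?D v z) \<partial>?M))"
    by (simp add: nn_integral_cmult nn_integral_add)
  finally show ?thesis by (simp add: gagliardo_int_def)
qed

text \<open>
  Lower semicontinuity; in particular it transfers a Cauchy estimate to the pointwise limit, which is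
  not yet known to have finite energy.
\<close>

lemma gagliardo_int_fatou:
  fixes u :: "nat \<Rightarrow> 'a::euclidean_space \<Rightarrow> real"
  assumes p: "0 < p" and u: "\<And>n. u n \<in> borel_measurable lebesgue"
    and lim: "AE x in lebesgue. (\<lambda>n. u n x) \<longlonglongrightarrow> l x"
  shows "gagliardo_int s p UNIV l \<le> liminf (\<lambda>n. gagliardo_int s p UNIV (u n))"
proof -
  let ?M = "frac_measure s p :: ('a \<times> 'a) measure"
  have "gagliardo_int s p UNIV l = (\<integral>\<^sup>+z. liminf (\<lambda>n. ennreal (\<bar>u n (fst z) - u n (snd z)\<bar> powr p)) \<partial>?M)"
    unfolding gagliardo_int_def
  proof (rule nn_integral_cong_AE)
    show "AE z in ?M. ennreal (\<bar>l (fst z) - l (snd z)\<bar> powr p) * indicator (UNIV \<times> UNIV) z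
        = liminf (\<lambda>n. ennreal (\<bar>u n (fst z) - u n (snd z)\<bar> powr p))"
      using AE_fst_snd[OF lim, of s p]
    proof eventually_elim
      case (elim z)
      then have "(\<lambda>n. ennreal (\<bar>u n (fst z) - u n (snd z)\<bar> powr p)) \<longlonglongrightarrow> ennreal (\<bar>l (fst z) - l (snd z)\<bar> powr p)"
        using p by (intro tendsto_ennrealI tendsto_powr2 tendsto_rabs tendsto_diff tendsto_const) auto
      from lim_imp_Liminf[OF trivial_limit_sequentially this] show ?case by simp
    qed
  qed
  also have "\<dots> \<le> liminf (\<lambda>n. \<integral>\<^sup>+z. ennreal (\<bar>u n (fst z) - u n (snd z)\<bar> powr p) \<partial>?M)"
  proof (rule nn_integral_liminf)
    fix n
    note [measurable] = gagliardo_seminorm_integral(1)[OF u[of n], of s p]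
    show "(\<lambda>z. ennreal (\<bar>u n (fst z) - u n (snd z)\<bar> powr p)) \<in> borel_measurable ?M" by measurable
  qed
  finally show ?thesis by (simp add: gagliardo_int_def)
qed

section \<open>Higher integrability of fractional Sobolev functions\<close>

text \<open>
  The mechanism behind the Sobolev inequality. On \<open>ball x h\<close> the \<open>L^r\<close> bound and Chebyshev's
  inequality leave at least half of the ball where \<open>|u| \<le> |u x| / 2\<close>. There \<open>|u x - u y|\<close> is at least
  \<open>|u x| / 2\<close> and the kernel is at least its value at distance \<open>h\<close>.
\<close>

lemma energy_density_ge:
  fixes u :: "'a::euclidean_space \<Rightarrow> real"
  assumes u: "u \<in> borel_measurable lebesgue" and U: "ball x h \<subseteq> U"
    and h: "0 < h" and p: "0 < p" and s: "0 < s" and r: "0 < r" and ux: "u x \<noteq> 0"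
    and I: "(\<integral>\<^sup>+y\<in>ball x h. ennreal (\<bar>u y\<bar> powr r) \<partial>lebesgue) \<le> ennreal I"
    and I_le: "2 * 2 powr r * I \<le> measure lebesgue (ball x h) * \<bar>u x\<bar> powr r"
  shows "ennreal ((\<bar>u x\<bar> / 2) powr p * h powr (- (real DIM('a) + p * s)) * (measure lebesgue (ball x h) / 2))
           \<le> frac_energy_density s p U u x"
proof -
  define B where "B = {y \<in> ball x h. 1 \<le> ennreal ((2 / \<bar>u x\<bar>) powr r) * ennreal (\<bar>u y\<bar> powr r)}"
  let ?\<alpha> = "(\<bar>u x\<bar> / 2) powr p * h powr (- (real DIM('a) + p * s))"
  note [measurable] = u
  let ?F = "\<lambda>y. ennreal ((2 / \<bar>u x\<bar>) powr r) * ennreal (\<bar>u y\<bar> powr r)"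
  have F: "?F \<in> borel_measurable lebesgue"
    by measurable
  have "B = ball x h \<inter> (?F -` {1..} \<inter> space lebesgue)" by (auto simp: B_def)
  also have "\<dots> \<in> sets lebesgue" using F by (intro sets.Int measurable_sets[OF F]) auto
  finally have B: "B \<in> sets lebesgue" .
  have fin: "emeasure lebesgue (ball x h) = ennreal (measure lebesgue (ball x h))"
    using emeasure_lborel_ball_finite[of x h] by (intro emeasure_eq_ennreal_measure) auto
  have "emeasure lebesgue B \<le> ennreal ((2 / \<bar>u x\<bar>) powr r) * (\<integral>\<^sup>+y\<in>ball x h. ennreal (\<bar>u y\<bar> powr r) \<partial>lebesgue)"
    unfolding B_def
  proof (rule nn_integral_Markov_inequality)
    have "(\<lambda>y. ennreal (\<bar>u y\<bar> powr r)) \<in> borel_measurable lebesgue" by measurable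
    then show "(\<lambda>y. ennreal (\<bar>u y\<bar> powr r) * indicator (ball x h) y) \<in> borel_measurable lebesgue"
      by (intro borel_measurable_times_ennreal borel_measurable_indicator) auto
  qed auto
  also have "\<dots> \<le> ennreal ((2 / \<bar>u x\<bar>) powr r) * ennreal I"
    by (intro mult_left_mono I) auto
  also have "\<dots> = ennreal ((2 / \<bar>u x\<bar>) powr r * I)" by (simp add: ennreal_mult')
  also have "\<dots> \<le> ennreal (measure lebesgue (ball x h) / 2)"
  proof (rule ennreal_leI)
    have "(2 / \<bar>u x\<bar>) powr r * I = 2 powr r * I / \<bar>u x\<bar> powr r"
      by (simp add: powr_divide)
    also have "\<dots> \<le> measure lebesgue (ball x h) / 2"
      using I_le ux by (simp add: pos_divide_le_eq)
    finally show "(2 / \<bar>u x\<bar>) powr r * I \<le> measure lebesgue (ball x h) / 2" .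
  qed
  finally have B_fin: "emeasure lebesgue B \<noteq> \<infinity>" and Bm: "emeasure lebesgue B \<le> ennreal (measure lebesgue (ball x h) / 2)"
    by (auto simp: top_unique)
  have B_sub: "B \<subseteq> ball x h" unfolding B_def by blast
  have "ennreal (measure lebesgue (ball x h) / 2) = ennreal (measure lebesgue (ball x h)) - ennreal (measure lebesgue (ball x h) / 2)"
    by (subst ennreal_minus) auto
  also have "\<dots> \<le> emeasure lebesgue (ball x h) - emeasure lebesgue B"
    unfolding fin by (intro ennreal_minus_mono Bm) auto
  also have "\<dots> = emeasure lebesgue (ball x h - B)"
    by (rule emeasure_Diff[symmetric, OF B_fin _ B B_sub]) auto
  finally have G: "ennreal (measure lebesgue (ball x h) / 2) \<le> emeasure lebesgue (ball x h - B)" .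
  have "ennreal (?\<alpha> * (measure lebesgue (ball x h) / 2)) = ennreal ?\<alpha> * ennreal (measure lebesgue (ball x h) / 2)"
    by (rule ennreal_mult) auto
  also have "\<dots> \<le> ennreal ?\<alpha> * emeasure lebesgue (ball x h - B)"
    by (intro mult_left_mono G) auto
  also have "\<dots> = (\<integral>\<^sup>+y. ennreal ?\<alpha> * indicator (ball x h - B) y \<partial>lebesgue)"
    by (rule nn_integral_cmult_indicator[symmetric]) (use B in auto)
  also have "\<dots> \<le> frac_energy_density s p U u x"
    unfolding frac_energy_density_def
  proof (rule nn_integral_mono)
    fix y
    show "ennreal ?\<alpha> * indicator (ball x h - B) y
            \<le> ennreal (\<bar>u x - u y\<bar> powr p * norm (x - y) powr (- (real DIM('a) + p * s))) * indicator U y"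
    proof (cases "y \<in> ball x h - B")
      case True
      then have d: "norm (x - y) < h" and "\<not> 1 \<le> ennreal ((2 / \<bar>u x\<bar>) powr r) * ennreal (\<bar>u y\<bar> powr r)"
        by (auto simp: dist_norm B_def)
      moreover have "(2 / \<bar>u x\<bar> * \<bar>u y\<bar>) powr r = (2 / \<bar>u x\<bar>) powr r * \<bar>u y\<bar> powr r"
        by (rule powr_mult)
      ultimately have "\<not> 1 \<le> ennreal ((2 / \<bar>u x\<bar> * \<bar>u y\<bar>) powr r)"
        by (simp only: ennreal_mult' powr_ge_zero not_False_eq_True)
      then have "(2 / \<bar>u x\<bar> * \<bar>u y\<bar>) powr r < 1" by (simp add: not_le)
      then have "2 / \<bar>u x\<bar> * \<bar>u y\<bar> < 1"
        using r ge_one_powr_ge_zero[of "2 / \<bar>u x\<bar> * \<bar>u y\<bar>" r] by linarith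
      then have lt: "\<bar>u y\<bar> < \<bar>u x\<bar> / 2" using ux by (simp add: field_simps)
      then have "x \<noteq> y" by auto
      have "?\<alpha> \<le> \<bar>u x - u y\<bar> powr p * norm (x - y) powr (- (real DIM('a) + p * s))"
      proof (rule mult_mono)
        show "(\<bar>u x\<bar> / 2) powr p \<le> \<bar>u x - u y\<bar> powr p"
          by (rule powr_mono2) (use lt p in \<open>simp, simp, linarith\<close>)
        show "h powr (- (real DIM('a) + p * s)) \<le> norm (x - y) powr (- (real DIM('a) + p * s))"
          using d \<open>x \<noteq> y\<close> mult_pos_pos[OF p s] by (intro powr_mono2') auto
      qed auto
      then show ?thesis using True U by (auto intro: ennreal_leI)
    qed auto
  qed
  finally show ?thesis .
qed

text \<open>
  With \<open>n\<close> the dimension, the radius \<open>h = \<kappa> |u x|^(-r/n)\<close> is just large enough for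
  \<open>energy_density_ge\<close> to apply; it turns that bound into \<open>c |u x|^(p + r p s / n)\<close>. Where \<open>|u x|\<close> is too
  small for \<open>h \<le> d\<close>, the function is bounded and \<open>A\<close> has finite measure.
\<close>

lemma integrability_gain:
  fixes u :: "'a::euclidean_space \<Rightarrow> real"
  assumes u: "u \<in> borel_measurable lebesgue"
    and U: "open U" "B \<subseteq> U" and gU: "gagliardo_int s p U u < \<infinity>"
    and A: "A \<in> sets lebesgue" "emeasure lebesgue A < \<infinity>"
    and d: "0 < d" "\<And>x. x \<in> A \<Longrightarrow> ball x d \<subseteq> B"
    and p: "0 < p" and s: "0 < s" and r: "0 < r"
    and uB: "(\<integral>\<^sup>+y\<in>B. ennreal (\<bar>u y\<bar> powr r) \<partial>lebesgue) < \<infinity>"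
  shows "(\<integral>\<^sup>+x\<in>A. ennreal (\<bar>u x\<bar> powr (p + r * (p * s / real DIM('a)))) \<partial>lebesgue) < \<infinity>"
proof -
  let ?n = "real DIM('a)"
  let ?e = "p + r * (p * s / ?n)"
  define \<omega> where "\<omega> = unit_ball_vol ?n"
  have n: "0 < ?n" and \<omega>: "0 < \<omega>" by (auto simp: \<omega>_def)
  have vol: "measure lebesgue (ball x h) = \<omega> * h powr ?n" if "0 < h" for x :: 'a and h
    using that content_ball[of h x] by (simp add: \<omega>_def powr_realpow measure_completion)
  define I where "I = enn2real (\<integral>\<^sup>+y\<in>B. ennreal (\<bar>u y\<bar> powr r) \<partial>lebesgue)"
  have I: "0 \<le> I" "(\<integral>\<^sup>+y\<in>B. ennreal (\<bar>u y\<bar> powr r) \<partial>lebesgue) = ennreal I"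
    using uB by (auto simp: I_def)
  \<comment> \<open>A ball of radius \<open>\<kappa> * t powr - (r / n)\<close> has measure \<open>2 * 2 powr r * (I + 1) * t powr - r\<close>;
    the summand \<open>1\<close> keeps \<open>\<kappa>\<close> positive when \<open>u\<close> vanishes on \<open>B\<close>.\<close>
  define \<kappa> where "\<kappa> = (2 * 2 powr r * (I + 1) / \<omega>) powr (1 / ?n)"
  have \<kappa>: "0 < \<kappa>" "\<omega> * \<kappa> powr ?n = 2 * 2 powr r * (I + 1)"
    using I \<omega> n by (auto simp: \<kappa>_def powr_powr)
  \<comment> \<open>Above the threshold \<open>t0\<close> the radius \<open>h\<close> is at most \<open>d\<close>.\<close>
  define t0 where "t0 = (\<kappa> / d) powr (?n / r)"
  have t0: "0 < t0" using \<kappa> d by (simp add: t0_def)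
  define c where "c = \<omega> / (2 * 2 powr p) * \<kappa> powr (- (p * s))"
  have c: "0 < c" using \<kappa> \<omega> by (simp add: c_def)
  have pt: "ennreal (\<bar>u x\<bar> powr ?e) * indicator A x
      \<le> ennreal (t0 powr ?e) * indicator A x + ennreal (1 / c) * (frac_energy_density s p U u x * indicator U x)" for x
  proof (cases "x \<in> A")
    case xA: True
    show ?thesis
    proof (cases "\<bar>u x\<bar> \<le> t0")
      case True
      then have "\<bar>u x\<bar> powr ?e \<le> t0 powr ?e"
        using p s r by (intro powr_mono2) auto
      then show ?thesis using xA by (simp add: add_increasing2 ennreal_leI)
    next
      case False
      define t where "t = \<bar>u x\<bar>"
      define h where "h = \<kappa> * t powr (- (r / ?n))"
      have t: "0 < t" "t0 < t" using False t0 by (auto simp: t_def)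
      have h: "0 < h" using \<kappa> t by (simp add: h_def)
      have "h \<le> \<kappa> * t0 powr (- (r / ?n))"
        unfolding h_def using \<kappa> t t0 r n by (intro mult_left_mono powr_mono2') auto
      also have "\<dots> = d"
        using \<kappa> d r n by (simp add: t0_def powr_powr powr_minus field_simps)
      finally have hd: "ball x h \<subseteq> ball x d" by auto
      have tn: "(t powr (- (r / ?n))) powr ?n = t powr (- r)" using n by (simp add: powr_powr)
      have "\<omega> * h powr ?n = \<omega> * \<kappa> powr ?n * t powr (- r)"
        unfolding h_def using \<kappa> t tn by (simp add: powr_mult)
      then have hn: "\<omega> * h powr ?n = 2 * 2 powr r * (I + 1) * t powr (- r)" using \<kappa> by simp
      have Ih: "(\<integral>\<^sup>+y\<in>ball x h. ennreal (\<bar>u y\<bar> powr r) \<partial>lebesgue) \<le> ennreal I"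
        unfolding I(2)[symmetric] using hd d(2)[OF xA] by (intro nn_set_integral_set_mono) auto
      have "ennreal ((\<bar>u x\<bar> / 2) powr p * h powr (- (?n + p * s)) * (measure lebesgue (ball x h) / 2))
           \<le> frac_energy_density s p U u x"
      proof (rule energy_density_ge[OF u _ h p s r _ Ih])
        show "ball x h \<subseteq> U" using hd d(2)[OF xA] U by blast
        show "u x \<noteq> 0" using t by (auto simp: t_def)
        have "measure lebesgue (ball x h) * t powr r = 2 * 2 powr r * (I + 1) * (t powr (- r) * t powr r)"
          unfolding vol[OF h] hn by simp
        also have "t powr (- r) * t powr r = 1" using t by (simp flip: powr_add)
        finally show "2 * 2 powr r * I \<le> measure lebesgue (ball x h) * \<bar>u x\<bar> powr r"
          using I by (simp add: t_def)
      qed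
      also have "(\<bar>u x\<bar> / 2) powr p * h powr (- (?n + p * s)) * (measure lebesgue (ball x h) / 2)
          = \<omega> / (2 * 2 powr p) * t powr p * h powr (- (p * s))"
      proof -
        have "h powr (- (?n + p * s)) = h powr (- (p * s)) / h powr ?n"
          by (simp flip: powr_diff add: add.commute)
        then show ?thesis unfolding vol[OF h] using h by (simp add: t_def powr_divide mult_ac)
      qed
      also have "\<dots> = c * t powr ?e"
      proof -
        have "h powr (- (p * s)) = \<kappa> powr (- (p * s)) * t powr (r * (p * s / ?n))"
          using \<kappa> t by (simp add: h_def powr_mult powr_powr)
        then show ?thesis by (simp add: c_def powr_add)
      qed
      finally have le: "ennreal (c * t powr ?e) \<le> frac_energy_density s p U u x" .
      have "ennreal (\<bar>u x\<bar> powr ?e) = ennreal (1 / c) * ennreal (c * t powr ?e)"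
        using c by (simp add: t_def flip: ennreal_mult)
      also have "\<dots> \<le> ennreal (1 / c) * frac_energy_density s p U u x"
        by (intro mult_left_mono le) auto
      finally have "ennreal (\<bar>u x\<bar> powr ?e) \<le> ennreal (1 / c) * frac_energy_density s p U u x" .
      moreover have "x \<in> U" using d xA U by (meson centre_in_ball subsetD)
      ultimately show ?thesis using xA by (simp add: add_increasing)
    qed
  qed simp
  have Um: "U \<in> sets lebesgue" using U by simp
  note en = gagliardo_int_eq_energy[OF u Um, where s=s and p=p]
  have enm: "(\<lambda>x. frac_energy_density s p U u x * indicator U x) \<in> borel_measurable lebesgue"
    by (intro borel_measurable_times_ennreal en(1) borel_measurable_indicator Um)
  have "(\<integral>\<^sup>+x\<in>A. ennreal (\<bar>u x\<bar> powr ?e) \<partial>lebesgue)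
      \<le> (\<integral>\<^sup>+x. ennreal (t0 powr ?e) * indicator A x + ennreal (1 / c) * (frac_energy_density s p U u x * indicator U x) \<partial>lebesgue)"
    by (intro nn_integral_mono pt)
  also have "\<dots> = ennreal (t0 powr ?e) * emeasure lebesgue A + ennreal (1 / c) * gagliardo_int s p U u"
    unfolding en(2) using A(1) enm
    by (subst nn_integral_add)
       (auto simp: nn_integral_cmult nn_integral_cmult_indicator
         intro!: borel_measurable_times_ennreal borel_measurable_indicator)
  also have "\<dots> < \<infinity>" using A(2) gU by (auto simp: ennreal_mult_less_top)
  finally show ?thesis .
qed

text \<open>
  The affine map \<open>r \<mapsto> p + r p s / n\<close> is a contraction with fixed point
  \<open>n p / (n - p s)\<close>, the critical exponent, so its iterates exceed every subcritical \<open>q\<close>.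
\<close>

lemma sobolev_exponent_iteration:
  fixes p s q n :: real
  assumes n: "0 < n" and p: "0 < p" and s: "0 < s" and ps: "p * s < n" and q: "q < n * p / (n - p * s)"
  shows "\<exists>k. q \<le> ((\<lambda>r. p + r * (p * s / n)) ^^ k) p"
proof -
  define \<theta> where "\<theta> = p * s / n"
  define L where "L = n * p / (n - p * s)"
  have \<theta>: "0 < \<theta>" "\<theta> < 1" using assms by (auto simp: \<theta>_def)
  have fix_L: "p + L * \<theta> = L"
    using ps n by (simp add: L_def \<theta>_def field_simps)
  have eq: "((\<lambda>r. p + r * \<theta>) ^^ k) p = L - \<theta> ^ k * (L - p)" for k
  proof (induction k)
    case (Suc k)
    have "((\<lambda>r. p + r * \<theta>) ^^ Suc k) p = p + (L - \<theta> ^ k * (L - p)) * \<theta>"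
      using Suc by simp
    also have "\<dots> = (p + L * \<theta>) - \<theta> * \<theta> ^ k * (L - p)"
      by (simp add: algebra_simps)
    finally have "((\<lambda>r. p + r * \<theta>) ^^ Suc k) p = (p + L * \<theta>) - \<theta> * \<theta> ^ k * (L - p)" .
    then show ?case unfolding fix_L by simp
  qed simp
  have "(\<lambda>k. L - \<theta> ^ k * (L - p)) \<longlonglongrightarrow> L - 0 * (L - p)"
    using \<theta> by (intro tendsto_intros LIMSEQ_power_zero) auto
  then have "eventually (\<lambda>k. q < L - \<theta> ^ k * (L - p)) sequentially"
    using q by (intro order_tendstoD) (simp_all add: L_def)
  then obtain k where "q < L - \<theta> ^ k * (L - p)" by (auto simp: eventually_sequentially)
  then have "q \<le> ((\<lambda>r. p + r * \<theta>) ^^ k) p" unfolding eq by simp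
  then show ?thesis unfolding \<theta>_def ..
qed

text \<open>
  Subcritical Sobolev embedding in the interior. Each step of the iteration loses a
  little of the neighbourhood of \<open>closure \<Omega>\<close>, so the induction runs over all radii
  \<open>\<delta> < D\<close> at once.
\<close>

lemma W_sp_Lq:
  fixes u :: "'a::euclidean_space \<Rightarrow> real"
  assumes u: "u \<in> borel_measurable lebesgue" "u \<in> W_sp s p U"
    and U: "open U" "closure \<Omega> \<subseteq> U" and \<Omega>: "bounded \<Omega>" "\<Omega> \<in> sets lebesgue"
    and p: "0 < p" and s: "0 < s" and ps: "p * s < real DIM('a)"
    and q: "0 \<le> q" "q < p_star TYPE('a) s p"
  shows "(\<integral>\<^sup>+x\<in>\<Omega>. ennreal (\<bar>u x\<bar> powr q) \<partial>lebesgue) < \<infinity>"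
proof -
  let ?n = "real DIM('a)"
  have gU: "gagliardo_int s p U u < \<infinity>" using u(2) by (simp add: W_sp_def)
  have "compact (closure \<Omega>)" using \<Omega> by (simp add: compact_closure)
  then obtain D where D: "0 < D" "(\<Union>x\<in>closure \<Omega>. ball x D) \<subseteq> U"
    using compact_subset_open_imp_ball_epsilon_subset[OF _ U] by metis
  define V where "V \<delta> = (\<Union>x\<in>closure \<Omega>. ball x \<delta>)" for \<delta>
  have V_open: "open (V \<delta>)" for \<delta> by (auto simp: V_def)
  have V_fin: "emeasure lebesgue (V \<delta>) < \<infinity>" for \<delta>
  proof -
    have "V \<delta> = {x + y |x y. x \<in> closure \<Omega> \<and> y \<in> ball 0 \<delta>}"
      by (force simp: V_def dist_norm norm_minus_commute intro: exI[of _ "_ - _"])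
    then have "bounded (V \<delta>)"
      using bounded_plus[OF bounded_closure[OF \<Omega>(1)] bounded_ball[of 0 \<delta>]]
      by (rule_tac bounded_subset) auto
    then show ?thesis using emeasure_bounded_finite[of "V \<delta>"] V_open by simp
  qed
  have V_U: "V \<delta> \<subseteq> U" if "\<delta> \<le> D" for \<delta> using D(2) that by (force simp: V_def)
  have V_ball: "ball x (\<delta>' - \<delta>) \<subseteq> V \<delta>'" if "x \<in> V \<delta>" for x \<delta> \<delta>'
  proof
    fix y assume y: "y \<in> ball x (\<delta>' - \<delta>)"
    obtain z where z: "z \<in> closure \<Omega>" "dist z x < \<delta>" using \<open>x \<in> V \<delta>\<close> by (auto simp: V_def)
    have "dist z y < \<delta>'" using z y dist_triangle[of z y x] by simp
    then show "y \<in> V \<delta>'" using z by (auto simp: V_def)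
  qed
  define R where "R k = ((\<lambda>r. p + r * (p * s / ?n)) ^^ k) p" for k
  have R_pos: "0 < R k" for k
    using p s by (induction k) (auto simp: R_def intro!: add_pos_nonneg)
  have main: "(\<integral>\<^sup>+x\<in>V \<delta>. ennreal (\<bar>u x\<bar> powr R k) \<partial>lebesgue) < \<infinity>" if "0 < \<delta>" "\<delta> < D" for k \<delta>
    using that
  proof (induction k arbitrary: \<delta>)
    case 0
    have "(\<integral>\<^sup>+x\<in>V \<delta>. ennreal (\<bar>u x\<bar> powr p) \<partial>lebesgue) \<le> (\<integral>\<^sup>+x\<in>U. ennreal (\<bar>u x\<bar> powr p) \<partial>lebesgue)"
      using V_U[of \<delta>] 0 by (intro nn_set_integral_set_mono) auto
    also have "\<dots> = (\<integral>\<^sup>+x. ennreal (\<bar>u x\<bar> powr p) \<partial>lebesgue_on U)"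
      using U by (subst nn_integral_restrict_space) auto
    also have "\<dots> < \<infinity>" using u(2) by (simp add: W_sp_def)
    finally show ?case by (simp add: R_def)
  next
    case (Suc k)
    define \<delta>' where "\<delta>' = (\<delta> + D) / 2"
    have \<delta>': "\<delta> < \<delta>'" "\<delta>' < D" using Suc.prems by (auto simp: \<delta>'_def)
    have "(\<integral>\<^sup>+x\<in>V \<delta>. ennreal (\<bar>u x\<bar> powr (p + R k * (p * s / ?n))) \<partial>lebesgue) < \<infinity>"
    proof (rule integrability_gain[OF u(1) U(1) V_U gU _ V_fin _ V_ball p s R_pos Suc.IH])
      show "V \<delta> \<in> sets lebesgue" using V_open by simp
    qed (use \<delta>' Suc.prems in auto)
    then show ?case by (simp add: R_def)
  qed
  obtain k where k: "q \<le> R k"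
    using sobolev_exponent_iteration[OF _ p s ps, of q] q(2) by (auto simp: R_def p_star_def)
  have fin: "(\<integral>\<^sup>+x\<in>\<Omega>. ennreal (\<bar>u x\<bar> powr R k) \<partial>lebesgue) < \<infinity>"
  proof (rule le_less_trans)
    have "\<Omega> \<subseteq> V (D / 2)" using closure_subset[of \<Omega>] D by (force simp: V_def)
    then show "(\<integral>\<^sup>+x\<in>\<Omega>. ennreal (\<bar>u x\<bar> powr R k) \<partial>lebesgue)
        \<le> (\<integral>\<^sup>+x\<in>V (D / 2). ennreal (\<bar>u x\<bar> powr R k) \<partial>lebesgue)"
      by (rule nn_set_integral_set_mono)
  qed (use main D in auto)
  have powr_le: "t powr q \<le> 1 + t powr R k" if "0 \<le> t" for t :: real
  proof (cases "t \<le> 1")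
    case True
    then have "t powr q \<le> 1" using that q(1) by (intro powr_le1) auto
    then show ?thesis by (simp add: add_increasing2)
  next
    case False
    then have "t powr q \<le> t powr R k" using k by (intro powr_mono) auto
    then show ?thesis by simp
  qed
  have m: "(\<lambda>x. ennreal (\<bar>u x\<bar> powr R k) * indicator \<Omega> x) \<in> borel_measurable lebesgue"
    using u(1) by (intro borel_measurable_times_ennreal borel_measurable_indicator \<Omega>) measurable
  have "ennreal (t powr q) \<le> 1 + ennreal (t powr R k)" if "0 \<le> t" for t
    using ennreal_leI[OF powr_le[OF that]] by (subst (asm) ennreal_plus) auto
  then have "(\<integral>\<^sup>+x\<in>\<Omega>. ennreal (\<bar>u x\<bar> powr q) \<partial>lebesgue)
      \<le> (\<integral>\<^sup>+x. indicator \<Omega> x + ennreal (\<bar>u x\<bar> powr R k) * indicator \<Omega> x \<partial>lebesgue)"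
    by (intro nn_integral_mono) (auto split: split_indicator)
  also have "\<dots> = emeasure lebesgue \<Omega> + (\<integral>\<^sup>+x\<in>\<Omega>. ennreal (\<bar>u x\<bar> powr R k) \<partial>lebesgue)"
    using \<Omega> m by (subst nn_integral_add) auto
  also have "\<dots> < \<infinity>" using fin fmeasurableD2[OF bounded_set_imp_lmeasurable[OF \<Omega>]]
    by (simp only: ennreal_add_less_top infinity_ennreal_def) (simp only: less_top)
  finally show ?thesis .
qed

lemma W_sp_Lq_integrable:
  fixes u :: "'a::euclidean_space \<Rightarrow> real"
  assumes u: "u \<in> borel_measurable lebesgue" "u \<in> W_sp s p U"
    and U: "open U" "closure \<Omega> \<subseteq> U" and \<Omega>: "bounded \<Omega>" "\<Omega> \<in> sets lebesgue"
    and p: "0 < p" and s: "0 < s" and ps: "p * s < real DIM('a)"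
    and q: "0 \<le> q" "q < p_star TYPE('a) s p"
  shows "integrable lebesgue (\<lambda>x. indicator \<Omega> x * \<bar>u x\<bar> powr q)"
proof (rule integrableI_nonneg)
  have "(\<lambda>x. \<bar>u x\<bar> powr q) \<in> borel_measurable lebesgue" using u(1) by measurable
  then show "(\<lambda>x. indicator \<Omega> x * \<bar>u x\<bar> powr q) \<in> borel_measurable lebesgue"
    by (intro borel_measurable_times borel_measurable_indicator \<Omega>(2))
  have "(\<integral>\<^sup>+x. ennreal (indicator \<Omega> x * \<bar>u x\<bar> powr q) \<partial>lebesgue) = (\<integral>\<^sup>+x\<in>\<Omega>. ennreal (\<bar>u x\<bar> powr q) \<partial>lebesgue)"
    by (intro nn_integral_cong) (auto split: split_indicator)
  then show "(\<integral>\<^sup>+x. ennreal (indicator \<Omega> x * \<bar>u x\<bar> powr q) \<partial>lebesgue) < \<infinity>"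
    using W_sp_Lq[OF u U \<Omega> p s ps q] by simp
qed simp

section \<open>Averages over cubic grids and compactness\<close>

text \<open>
  Cells are half-open cubes addressed by their points rather than by an index, so that a cell average
  is again a function on the space and needs no sum over cells.
\<close>

definition grid_cell :: "real \<Rightarrow> 'a::euclidean_space \<Rightarrow> 'a set" where
  "grid_cell h x = {y. \<forall>b\<in>Basis. \<lfloor>(y \<bullet> b) / h\<rfloor> = \<lfloor>(x \<bullet> b) / h\<rfloor>}"

definition cell_average :: "real \<Rightarrow> ('a::euclidean_space \<Rightarrow> real) \<Rightarrow> 'a \<Rightarrow> real" where
  "cell_average h u x = (LINT y:grid_cell h x|lebesgue. u y) / h ^ DIM('a)"

text \<open>
  A cell lies between the open and the closed cube of side \<open>h\<close> with the same vertices.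
\<close>

lemma grid_cell_measure:
  fixes x :: "'a::euclidean_space"
  assumes h: "0 < h"
  shows "grid_cell h x \<in> sets borel"
    and "emeasure lebesgue (grid_cell h x) = ennreal (h ^ DIM('a))"
proof -
  show m: "grid_cell h x \<in> sets borel"
    unfolding grid_cell_def by measurable
  define l where "l = (\<Sum>b\<in>Basis. (h * of_int \<lfloor>(x \<bullet> b) / h\<rfloor>) *\<^sub>R b)"
  define r where "r = (\<Sum>b\<in>Basis. (h * (of_int \<lfloor>(x \<bullet> b) / h\<rfloor> + 1)) *\<^sub>R b)"
  have lb: "l \<bullet> b = h * of_int \<lfloor>(x \<bullet> b) / h\<rfloor>" and rb: "r \<bullet> b = h * (of_int \<lfloor>(x \<bullet> b) / h\<rfloor> + 1)"
    if "b \<in> Basis" for b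
    using that by (simp_all add: l_def r_def)
  have "emeasure lborel (box l r) = ennreal (\<Prod>b\<in>Basis. (r - l) \<bullet> b)"
    using h by (intro emeasure_lborel_box) (simp add: lb rb)
  also have "(\<Prod>b\<in>Basis. (r - l) \<bullet> b) = (\<Prod>b\<in>(Basis::'a set). h)"
    by (intro prod.cong refl) (simp add: lb rb inner_diff_left algebra_simps)
  finally have bx: "emeasure lborel (box l r) = ennreal (h ^ DIM('a))" by simp
  have "emeasure lborel (cbox l r) = ennreal (\<Prod>b\<in>Basis. (r - l) \<bullet> b)"
    using h by (intro emeasure_lborel_cbox) (simp add: lb rb)
  also have "(\<Prod>b\<in>Basis. (r - l) \<bullet> b) = (\<Prod>b\<in>(Basis::'a set). h)"
    by (intro prod.cong refl) (simp add: lb rb inner_diff_left algebra_simps)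
  finally have cbx: "emeasure lborel (cbox l r) = ennreal (h ^ DIM('a))" by simp
  have "box l r \<subseteq> grid_cell h x"
  proof
    fix y assume y: "y \<in> box l r"
    show "y \<in> grid_cell h x"
      unfolding grid_cell_def
    proof safe
      fix b :: 'a assume b: "b \<in> Basis"
      then have "h * of_int \<lfloor>(x \<bullet> b) / h\<rfloor> < y \<bullet> b" "y \<bullet> b < h * (of_int \<lfloor>(x \<bullet> b) / h\<rfloor> + 1)"
        using y by (auto simp: mem_box lb rb)
      then have "of_int \<lfloor>(x \<bullet> b) / h\<rfloor> \<le> y \<bullet> b / h" "y \<bullet> b / h < of_int \<lfloor>(x \<bullet> b) / h\<rfloor> + 1"
        using h by (auto simp: pos_le_divide_eq pos_divide_less_eq mult.commute)
      then show "\<lfloor>(y \<bullet> b) / h\<rfloor> = \<lfloor>(x \<bullet> b) / h\<rfloor>" by (rule floor_unique)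
    qed
  qed
  then have "emeasure lborel (box l r) \<le> emeasure lborel (grid_cell h x)"
    using m by (intro emeasure_mono) auto
  moreover have "grid_cell h x \<subseteq> cbox l r"
  proof
    fix y assume y: "y \<in> grid_cell h x"
    show "y \<in> cbox l r"
      unfolding mem_box
    proof safe
      fix b :: 'a assume b: "b \<in> Basis"
      have "\<lfloor>(y \<bullet> b) / h\<rfloor> = \<lfloor>(x \<bullet> b) / h\<rfloor>" using y b by (simp add: grid_cell_def)
      then have "of_int \<lfloor>(x \<bullet> b) / h\<rfloor> \<le> y \<bullet> b / h" "y \<bullet> b / h \<le> of_int \<lfloor>(x \<bullet> b) / h\<rfloor> + 1"
        by linarith+
      then show "l \<bullet> b \<le> y \<bullet> b" "y \<bullet> b \<le> r \<bullet> b"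
        using h b by (auto simp: lb rb pos_le_divide_eq pos_divide_le_eq mult.commute)
    qed
  qed
  then have "emeasure lborel (grid_cell h x) \<le> emeasure lborel (cbox l r)"
    by (intro emeasure_mono) auto
  ultimately show "emeasure lebesgue (grid_cell h x) = ennreal (h ^ DIM('a))"
    using m bx cbx by (simp add: order_antisym)
qed

lemma grid_cell_diameter:
  fixes x y :: "'a::euclidean_space"
  assumes h: "0 < h" and y: "y \<in> grid_cell h x"
  shows "norm (x - y) \<le> h * real DIM('a)"
proof -
  have "\<bar>(x - y) \<bullet> b\<bar> \<le> h" if b: "b \<in> Basis" for b
  proof -
    have "\<lfloor>(y \<bullet> b) / h\<rfloor> = \<lfloor>(x \<bullet> b) / h\<rfloor>" using y b by (simp add: grid_cell_def)
    then have "\<bar>(x \<bullet> b) / h - (y \<bullet> b) / h\<bar> \<le> 1" by linarith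
    also have "(x \<bullet> b) / h - (y \<bullet> b) / h = ((x - y) \<bullet> b) / h"
      by (simp add: inner_diff_left diff_divide_distrib)
    finally show ?thesis using h by (simp add: abs_divide)
  qed
  then have "(\<Sum>b\<in>Basis. \<bar>(x - y) \<bullet> b\<bar>) \<le> (\<Sum>b\<in>(Basis::'a set). h)" by (intro sum_mono) auto
  then show ?thesis using norm_le_l1[of "x - y"] by (simp add: mult.commute)
qed

lemma countable_grid_cells: "countable (range (grid_cell h :: 'a::euclidean_space \<Rightarrow> 'a set))"
proof -
  let ?J = "\<lambda>x::'a. restrict (\<lambda>b. \<lfloor>(x \<bullet> b) / h\<rfloor>) Basis"
  let ?C = "\<lambda>k. {y::'a. \<forall>b\<in>Basis. \<lfloor>(y \<bullet> b) / h\<rfloor> = k b}"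
  have "grid_cell h x = ?C (?J x)" for x :: 'a by (auto simp: grid_cell_def)
  then have "range (grid_cell h) \<subseteq> ?C ` (PiE (Basis :: 'a set) (\<lambda>_. UNIV :: int set))"
    by (force intro!: image_eqI[of _ _ "?J _"])
  moreover have "countable (?C ` (PiE (Basis :: 'a set) (\<lambda>_. UNIV :: int set)))"
    by (intro countable_image countable_PiE) auto
  ultimately show ?thesis by (rule countable_subset)
qed

lemma cell_average_measurable:
  fixes u :: "'a::euclidean_space \<Rightarrow> real"
  assumes u: "u \<in> borel_measurable lebesgue"
  shows "cell_average h u \<in> borel_measurable lebesgue"
proof -
  interpret L: sigma_finite_measure "lebesgue :: 'a measure"
    by (rule sigma_finite_lebesgue)
  define S where "S = {z :: 'a \<times> 'a. snd z \<in> grid_cell h (fst z)}"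
  have f: "fst \<in> (lebesgue \<Otimes>\<^sub>M lebesgue :: ('a \<times> 'a) measure) \<rightarrow>\<^sub>M borel"
    and s: "snd \<in> (lebesgue \<Otimes>\<^sub>M lebesgue :: ('a \<times> 'a) measure) \<rightarrow>\<^sub>M borel"
    by (rule borel_id_lebesgue, rule measurable_fst, rule borel_id_lebesgue, rule measurable_snd)
  have "{z \<in> space (lebesgue \<Otimes>\<^sub>M lebesgue). \<forall>b\<in>(Basis::'a set). \<lfloor>(snd z \<bullet> b) / h\<rfloor> = \<lfloor>(fst z \<bullet> b) / h\<rfloor>}
      \<in> sets (lebesgue \<Otimes>\<^sub>M lebesgue)"
    using f s by measurable
  then have S: "S \<in> sets (lebesgue \<Otimes>\<^sub>M lebesgue)"
    by (simp add: S_def grid_cell_def space_pair_measure)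
  have m: "(\<lambda>z. indicator S z *\<^sub>R u (snd z)) \<in> borel_measurable (lebesgue \<Otimes>\<^sub>M lebesgue)"
    using S u by (intro borel_measurable_scaleR borel_measurable_indicator measurable_compose[OF measurable_snd]) auto
  then have "(\<lambda>x. LINT y|lebesgue. (\<lambda>z. indicator S z *\<^sub>R u (snd z)) (x, y)) \<in> borel_measurable lebesgue"
    by (intro L.borel_measurable_lebesgue_integral) (simp add: case_prod_beta')
  then have "(\<lambda>x. (LINT y:grid_cell h x|lebesgue. u y) / h ^ DIM('a)) \<in> borel_measurable lebesgue"
    by (intro borel_measurable_divide borel_measurable_const) (simp add: S_def set_lebesgue_integral_def indicator_def)
  then show ?thesis by (simp add: cell_average_def[abs_def])
qed

lemma set_integral_bound_dominated:
  fixes u g :: "'a::euclidean_space \<Rightarrow> real"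
  assumes u: "u \<in> borel_measurable lebesgue"
    and g: "integrable lebesgue g" "AE x in lebesgue. \<bar>u x\<bar> \<le> g x"
  shows "\<bar>LINT y:E|lebesgue. u y\<bar> \<le> (LINT x|lebesgue. g x)"
proof -
  have "\<bar>LINT y:E|lebesgue. u y\<bar> \<le> (LINT y|lebesgue. norm (indicator E y *\<^sub>R u y))"
    unfolding set_lebesgue_integral_def using integral_norm_bound by force
  also have "\<dots> \<le> (LINT y|lebesgue. g y)"
    using g by (intro integral_mono_AE') (auto elim!: eventually_mono split: split_indicator)
  finally show ?thesis .
qed

lemma cell_average_diff:
  fixes u v :: "'a::euclidean_space \<Rightarrow> real"
  assumes "0 < h" "integrable lebesgue u" "integrable lebesgue v"
  shows "cell_average h (\<lambda>x. u x - v x) x = cell_average h u x - cell_average h v x"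
proof -
  have C: "grid_cell h x \<in> sets lebesgue"
    using grid_cell_measure(1)[OF assms(1), of x] by simp
  have "set_integrable lebesgue (grid_cell h x) u" "set_integrable lebesgue (grid_cell h x) v"
    unfolding set_integrable_def using assms(2,3) by (auto intro!: integrable_mult_indicator[OF C] simp del: real_scaleR_def)
  from set_integral_diff(2)[OF this] show ?thesis
    by (simp add: cell_average_def diff_divide_distrib)
qed

text \<open>
  The difference between \<open>w x\<close> and the average over its cell is at most the average of
  \<open>|w x - w y|\<close>. Young's inequality splits it into \<open>\<delta>\<close> and a \<open>p\<close>-th power; the latter is controlled by
  the energy density since \<open>norm (x - y) \<le> h n\<close> on the cell. The exponents leave the factor
  \<open>h powr (p * s)\<close>, which vanishes with the mesh.
\<close>

lemma abs_le_cell_average: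
  fixes w :: "'a::euclidean_space \<Rightarrow> real"
  assumes h: "0 < h" and \<delta>: "0 < \<delta>" and p: "1 \<le> p" and s: "0 < s" and w: "integrable lebesgue w"
  defines "n \<equiv> real DIM('a)"
  shows "ennreal \<bar>w x\<bar> \<le> ennreal \<bar>cell_average h w x\<bar> + ennreal \<delta>
           + ennreal (\<delta> powr (1 - p) * n powr (n + p * s) * h powr (p * s)) * frac_energy_density s p UNIV w x"
proof -
  let ?C = "grid_cell h x"
  let ?K = "\<lambda>y. norm (x - y) powr (- (n + p * s))"
  define c where "c = \<delta> powr (1 - p) * (h * n) powr (n + p * s)"
  have n: "0 < n" by (simp add: n_def)
  have c: "0 < c" using \<delta> h n by (simp add: c_def)
  have hn: "h ^ DIM('a) = h powr n" using h by (simp add: n_def powr_realpow)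
  have C: "?C \<in> sets lebesgue" "emeasure lebesgue ?C = ennreal (h powr n)"
    using grid_cell_measure[OF h, of x] hn by auto
  have wm: "w \<in> borel_measurable lebesgue" using w by auto
  have i1: "integrable lebesgue (\<lambda>y. indicator ?C y *\<^sub>R w x)"
    using C by (intro integrable_scaleR_left integrable_real_indicator) auto
  have i2: "integrable lebesgue (\<lambda>y. indicator ?C y *\<^sub>R w y)"
    using w C by (intro integrable_mult_indicator) auto
  have "(LINT y|lebesgue. indicator ?C y *\<^sub>R w x) = h powr n * w x"
    using C by (simp add: measure_def)
  moreover have "(LINT y|lebesgue. indicator ?C y *\<^sub>R w y) = h powr n * cell_average h w x"
    using h by (simp add: cell_average_def set_lebesgue_integral_def hn)
  ultimately have "h powr n * (w x - cell_average h w x)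
      = (LINT y|lebesgue. indicator ?C y *\<^sub>R w x - indicator ?C y *\<^sub>R w y)"
    by (simp add: right_diff_distrib Bochner_Integration.integral_diff[OF i1 i2] del: real_scaleR_def)
  then have "ennreal (h powr n * \<bar>w x - cell_average h w x\<bar>)
      = ennreal (norm (LINT y|lebesgue. indicator ?C y *\<^sub>R w x - indicator ?C y *\<^sub>R w y))"
    using h by (metis abs_mult abs_of_nonneg powr_ge_zero real_norm_def)
  also have "\<dots> \<le> (\<integral>\<^sup>+y. norm (indicator ?C y *\<^sub>R w x - indicator ?C y *\<^sub>R w y) \<partial>lebesgue)"
    using i1 i2 by (intro integral_norm_bound_ennreal) auto
  also have "\<dots> \<le> (\<integral>\<^sup>+y. ennreal \<delta> * indicator ?C y + ennreal c * ennreal (\<bar>w x - w y\<bar> powr p * ?K y) \<partial>lebesgue)"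
  proof (rule nn_integral_mono)
    fix y
    show "ennreal (norm (indicator ?C y *\<^sub>R w x - indicator ?C y *\<^sub>R w y))
        \<le> ennreal \<delta> * indicator ?C y + ennreal c * ennreal (\<bar>w x - w y\<bar> powr p * ?K y)"
    proof (cases "y \<in> ?C")
      case True
      have "\<bar>w x - w y\<bar> \<le> \<delta> + c * (\<bar>w x - w y\<bar> powr p * ?K y)"
      proof (cases "x = y")
        case False
        have "1 \<le> (h * n) powr (n + p * s) * ?K y"
        proof -
          have "norm (x - y) powr (n + p * s) \<le> (h * n) powr (n + p * s)"
            using grid_cell_diameter[OF h True] n p s by (intro powr_mono2) (auto simp: n_def)
          then have "norm (x - y) powr (n + p * s) * ?K y \<le> (h * n) powr (n + p * s) * ?K y"
            by (intro mult_right_mono) auto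
          then show ?thesis using False by (simp flip: powr_add)
        qed
        then have "\<delta> powr (1 - p) * \<bar>w x - w y\<bar> powr p * 1
            \<le> \<delta> powr (1 - p) * \<bar>w x - w y\<bar> powr p * ((h * n) powr (n + p * s) * ?K y)"
          by (intro mult_left_mono) auto
        then show ?thesis
          using abs_le_young[OF \<delta> p, of "\<bar>w x - w y\<bar>"] by (simp add: c_def mult_ac)
      qed (use \<delta> in simp)
      then have "ennreal \<bar>w x - w y\<bar> \<le> ennreal (\<delta> + c * (\<bar>w x - w y\<bar> powr p * ?K y))"
        by (rule ennreal_leI)
      also have "\<dots> = ennreal \<delta> + ennreal c * ennreal (\<bar>w x - w y\<bar> powr p * ?K y)"
        using \<delta> c by (simp add: ennreal_plus ennreal_mult)
      finally show ?thesis using True by simp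
    qed simp
  qed
  also have "\<dots> = ennreal \<delta> * ennreal (h powr n) + ennreal c * frac_energy_density s p UNIV w x"
  proof -
    have m: "(\<lambda>y. ennreal (\<bar>w x - w y\<bar> powr p * ?K y)) \<in> borel_measurable lebesgue"
      using measurable_compose[OF measurable_Pair1'[of x lebesgue lebesgue]
          difference_quotient_measurable[OF wm, of p "- (n + p * s)"]]
      by simp
    have e: "(\<integral>\<^sup>+y. ennreal (\<bar>w x - w y\<bar> powr p * ?K y) \<partial>lebesgue) = frac_energy_density s p UNIV w x"
      by (simp add: frac_energy_density_def n_def)
    have i: "(\<lambda>y. ennreal \<delta> * indicator ?C y) \<in> borel_measurable lebesgue"
      by (intro borel_measurable_times_ennreal borel_measurable_const borel_measurable_indicator C(1))
    have cm: "(\<lambda>y. ennreal c * ennreal (\<bar>w x - w y\<bar> powr p * ?K y)) \<in> borel_measurable lebesgue"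
      by (intro borel_measurable_times_ennreal borel_measurable_const m)
    show ?thesis
      by (subst nn_integral_add[OF i cm], subst nn_integral_cmult_indicator[OF C(1)],
          subst nn_integral_cmult[OF m], subst e) (simp only: C(2))
  qed
  finally have le: "ennreal (h powr n * \<bar>w x - cell_average h w x\<bar>)
      \<le> ennreal \<delta> * ennreal (h powr n) + ennreal c * frac_energy_density s p UNIV w x" .
  have "ennreal \<bar>w x\<bar> \<le> ennreal (\<bar>cell_average h w x\<bar> + h powr (- n) * (h powr n * \<bar>w x - cell_average h w x\<bar>))"
    using h by (intro ennreal_leI) (auto simp: mult.assoc[symmetric] simp flip: powr_add)
  also have "\<dots> = ennreal \<bar>cell_average h w x\<bar> + ennreal (h powr (- n)) * ennreal (h powr n * \<bar>w x - cell_average h w x\<bar>)"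
    by (simp add: ennreal_plus ennreal_mult)
  also have "\<dots> \<le> ennreal \<bar>cell_average h w x\<bar>
      + ennreal (h powr (- n)) * (ennreal \<delta> * ennreal (h powr n) + ennreal c * frac_energy_density s p UNIV w x)"
    by (intro add_left_mono mult_left_mono le) auto
  also have "\<dots> = ennreal \<bar>cell_average h w x\<bar> + (ennreal (h powr (- n) * \<delta> * h powr n)
      + ennreal (h powr (- n) * c) * frac_energy_density s p UNIV w x)"
    using \<delta> c by (simp add: distrib_left ennreal_mult mult.assoc)
  also have "h powr (- n) * \<delta> * h powr n = \<delta>" using h by (simp add: powr_minus)
  also have "h powr (- n) * c = \<delta> powr (1 - p) * n powr (n + p * s) * h powr (p * s)"
  proof -
    have "(h * n) powr (n + p * s) = h powr n * h powr (p * s) * n powr (n + p * s)"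
      by (simp add: powr_mult powr_add)
    then show ?thesis using h by (simp add: c_def powr_minus)
  qed
  finally show ?thesis by (simp add: add.assoc)
qed

lemma L1_le_cell_average:
  fixes w :: "'a::euclidean_space \<Rightarrow> real"
  assumes h: "0 < h" and \<delta>: "0 < \<delta>" and p: "1 \<le> p" and s: "0 < s" and w: "integrable lebesgue w"
    and \<Omega>: "\<Omega> \<in> sets lebesgue"
  defines "n \<equiv> real DIM('a)"
  shows "(\<integral>\<^sup>+x\<in>\<Omega>. ennreal \<bar>w x\<bar> \<partial>lebesgue)
    \<le> (\<integral>\<^sup>+x\<in>\<Omega>. ennreal \<bar>cell_average h w x\<bar> \<partial>lebesgue) + ennreal \<delta> * emeasure lebesgue \<Omega>
       + ennreal (\<delta> powr (1 - p) * n powr (n + p * s) * h powr (p * s)) * gagliardo_int s p UNIV w"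
proof -
  let ?c = "\<delta> powr (1 - p) * n powr (n + p * s) * h powr (p * s)"
  let ?e = "frac_energy_density s p UNIV w"
  have wm: "w \<in> borel_measurable lebesgue" using w by auto
  note en = gagliardo_int_eq_energy[OF wm sets.top, where s=s and p=p, simplified]
  have am: "(\<lambda>x. ennreal \<bar>cell_average h w x\<bar> * indicator \<Omega> x) \<in> borel_measurable lebesgue"
    using cell_average_measurable[OF wm, of h]
    by (intro borel_measurable_times_ennreal borel_measurable_indicator \<Omega>) measurable
  have im: "(\<lambda>x. ennreal \<delta> * indicator \<Omega> x) \<in> borel_measurable lebesgue"
    by (intro borel_measurable_times_ennreal borel_measurable_indicator \<Omega> borel_measurable_const)
  have em: "(\<lambda>x. ennreal ?c * ?e x) \<in> borel_measurable lebesgue"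
    by (intro borel_measurable_times_ennreal en(1) borel_measurable_const)
  have "(\<integral>\<^sup>+x\<in>\<Omega>. ennreal \<bar>w x\<bar> \<partial>lebesgue)
    \<le> (\<integral>\<^sup>+x. (ennreal \<bar>cell_average h w x\<bar> * indicator \<Omega> x + ennreal \<delta> * indicator \<Omega> x) + ennreal ?c * ?e x \<partial>lebesgue)"
  proof (rule nn_integral_mono)
    fix x
    show "ennreal \<bar>w x\<bar> * indicator \<Omega> x
        \<le> (ennreal \<bar>cell_average h w x\<bar> * indicator \<Omega> x + ennreal \<delta> * indicator \<Omega> x) + ennreal ?c * ?e x"
      using abs_le_cell_average[OF h \<delta> p s w, of x] unfolding n_def by (cases "x \<in> \<Omega>") auto
  qed
  also have "\<dots> = (\<integral>\<^sup>+x\<in>\<Omega>. ennreal \<bar>cell_average h w x\<bar> \<partial>lebesgue) + ennreal \<delta> * emeasure lebesgue \<Omega>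
       + ennreal ?c * gagliardo_int s p UNIV w"
    unfolding en(2)
    by (subst nn_integral_add[OF borel_measurable_add[OF am im] em], subst nn_integral_add[OF am im],
        subst nn_integral_cmult_indicator[OF \<Omega>], subst nn_integral_cmult[OF en(1)]) simp
  finally show ?thesis .
qed

text \<open>
  Only countably many cells occur for the meshes \<open>1 / (j + 1)\<close>, so Cantor's diagonal argument applies
  to the bounded sequences of integrals over them.
\<close>

lemma bounded_subseq_cell_averages_converge:
  fixes u :: "nat \<Rightarrow> 'a::euclidean_space \<Rightarrow> real"
  assumes u: "\<And>n. u n \<in> borel_measurable lebesgue"
    and g: "integrable lebesgue g" "\<And>n. AE x in lebesgue. \<bar>u n x\<bar> \<le> g x"
  obtains r where "strict_mono (r :: nat \<Rightarrow> nat)"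
    "\<forall>j x. convergent (\<lambda>n. cell_average (1 / real (Suc j)) (u (r n)) x)"
proof -
  let ?S = "\<Union>j. range (grid_cell (1 / real (Suc j)) :: 'a \<Rightarrow> 'a set)"
  have "countable ?S" by (intro countable_UN countable_grid_cells) auto
  moreover have "norm (LINT y:E|lebesgue. u n y) \<le> (LINT x|lebesgue. g x)" for n E
    using set_integral_bound_dominated[OF u g] by simp
  ultimately obtain r where r: "strict_mono (r :: nat \<Rightarrow> nat)"
    "\<And>E. E \<in> ?S \<Longrightarrow> \<exists>l. (\<lambda>n. LINT y:E|lebesgue. u (r n) y) \<longlonglongrightarrow> l"
    using function_convergent_subsequence[of ?S "\<lambda>n E. LINT y:E|lebesgue. u n y"] by metis
  have "convergent (\<lambda>n. cell_average (1 / real (Suc j)) (u (r n)) x)" for j x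
  proof -
    let ?h = "1 / real (Suc j)"
    obtain l where "(\<lambda>n. LINT y:grid_cell ?h x|lebesgue. u (r n) y) \<longlonglongrightarrow> l"
      using r(2)[of "grid_cell ?h x"] by blast
    then have "(\<lambda>n. cell_average ?h (u (r n)) x) \<longlonglongrightarrow> l / ?h ^ DIM('a)"
      unfolding cell_average_def by (rule tendsto_divide[OF _ tendsto_const]) auto
    then show ?thesis by (rule convergentI)
  qed
  with r(1) show ?thesis by (intro that) auto
qed

text \<open>
  A dominated form of the Rellich--Kondrachov theorem. The majorant \<open>g\<close> makes the integrals
  over cells bounded and justifies dominated convergence for the averages at a fixed mesh.
\<close>

lemma rellich_dominated:
  fixes u :: "nat \<Rightarrow> 'a::euclidean_space \<Rightarrow> real"
  assumes p: "1 \<le> p" and s: "0 < s" and \<Omega>: "\<Omega> \<in> sets lebesgue" "emeasure lebesgue \<Omega> < \<infinity>"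
    and u: "\<And>n. u n \<in> borel_measurable lebesgue"
    and u0: "\<And>n. AE x in lebesgue. x \<notin> \<Omega> \<longrightarrow> u n x = 0"
    and g: "integrable lebesgue g" "\<And>n. AE x in lebesgue. \<bar>u n x\<bar> \<le> g x"
    and K: "\<And>n. gagliardo_int s p UNIV (u n) \<le> ennreal K"
  obtains r where "strict_mono (r :: nat \<Rightarrow> nat)" "AE x in lebesgue. Cauchy (\<lambda>n. u (r n) x)"
proof -
  let ?n = "real DIM('a)"
  obtain r where r: "strict_mono (r :: nat \<Rightarrow> nat)"
    and conv: "\<forall>j x. convergent (\<lambda>n. cell_average (1 / real (Suc j)) (u (r n)) x)"
    by (rule bounded_subseq_cell_averages_converge[where u=u and g=g, OF u g])
  define v where "v n = u (r n)" for n
  have vm: "v n \<in> borel_measurable lebesgue" for n using u by (simp add: v_def)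
  have vi: "integrable lebesgue (v n)" for n
    by (rule Bochner_Integration.integrable_bound[OF g(1) vm])
       (use g(2)[of "r n"] in \<open>auto simp: v_def elim!: eventually_mono\<close>)
  have GD: "gagliardo_int s p UNIV (\<lambda>x. v i x - v j x) \<le> ennreal (2 powr p * (2 * \<bar>K\<bar>))" for i j
  proof -
    have K': "gagliardo_int s p UNIV (v i) \<le> ennreal \<bar>K\<bar>" for i
      using K[of "r i"] unfolding v_def by (rule order_trans) (auto intro: ennreal_leI)
    have "gagliardo_int s p UNIV (\<lambda>x. v i x - v j x)
        \<le> ennreal (2 powr p) * (gagliardo_int s p UNIV (v i) + gagliardo_int s p UNIV (v j))"
      using p by (intro gagliardo_int_diff_le vm) auto
    also have "\<dots> \<le> ennreal (2 powr p) * (ennreal \<bar>K\<bar> + ennreal \<bar>K\<bar>)"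
      by (intro mult_left_mono add_mono K') auto
    also have "\<dots> = ennreal (2 powr p) * ennreal (2 * \<bar>K\<bar>)"
      by (simp flip: ennreal_plus)
    also have "\<dots> = ennreal (2 powr p * (2 * \<bar>K\<bar>))"
      by (rule ennreal_mult[symmetric]) auto
    finally show ?thesis .
  qed
  have cauchy: "\<exists>N. \<forall>i\<ge>N. \<forall>j\<ge>N. (LINT x|lebesgue. norm (v i x - v j x)) < e" if e: "0 < e" for e
  proof -
    define m where "m = measure lebesgue \<Omega>"
    have m: "emeasure lebesgue \<Omega> = ennreal m" "0 \<le> m"
      using \<Omega>(2) by (auto simp: m_def emeasure_eq_ennreal_measure)
    \<comment> \<open>The error terms sum to \<open>7 e / 8\<close>: twice \<open>e / 4\<close> for the distances of the two averages to their limit,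
      \<open>e / 8\<close> from \<open>\<delta>\<close>, and \<open>e / 4\<close> from the energy.\<close>
    define \<delta> where "\<delta> = e / (8 * (m + 1))"
    have \<delta>: "0 < \<delta>" "\<delta> * m \<le> e / 8"
      using e m by (auto simp: \<delta>_def field_simps)
    define c where "c = \<delta> powr (1 - p) * ?n powr (?n + p * s)"
    have "(\<lambda>j. c * (1 / real (Suc j)) powr (p * s) * (2 powr p * (2 * \<bar>K\<bar>))) \<longlonglongrightarrow> c * 0 powr (p * s) * (2 powr p * (2 * \<bar>K\<bar>))"
      using LIMSEQ_inverse_real_of_nat p s
      by (intro tendsto_mult tendsto_const tendsto_powr2) (auto simp: inverse_eq_divide)
    then have "eventually (\<lambda>j. c * (1 / real (Suc j)) powr (p * s) * (2 powr p * (2 * \<bar>K\<bar>)) < e / 4) sequentially"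
      using e by (intro order_tendstoD) auto
    then obtain j0 where j0: "c * (1 / real (Suc j0)) powr (p * s) * (2 powr p * (2 * \<bar>K\<bar>)) < e / 4"
      by (auto simp: eventually_sequentially)
    define h where "h = 1 / real (Suc j0)"
    have h: "0 < h" by (simp add: h_def)
    define A where "A n x = indicator \<Omega> x * cell_average h (v n) x" for n x
    have Am: "A n \<in> borel_measurable lebesgue" for n
      unfolding A_def[abs_def]
      by (intro borel_measurable_times borel_measurable_indicator \<Omega> cell_average_measurable vm)
    define L where "L x = lim (\<lambda>n. A n x)" for x
    have Lm: "L \<in> borel_measurable lebesgue"
      unfolding L_def[abs_def] by (rule borel_measurable_lim_metric) (rule Am)
    have LAm: "(\<lambda>x. ennreal (norm (L x - A n x))) \<in> borel_measurable lebesgue" for n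
      using Am[of n] Lm by measurable
    have AL: "(\<lambda>n. A n x) \<longlonglongrightarrow> L x" for x
    proof -
      have "convergent (\<lambda>n. A n x)"
        unfolding A_def v_def h_def by (intro convergent_mult convergent_const conv[rule_format])
      then show ?thesis unfolding L_def by (simp add: convergent_LIMSEQ_iff)
    qed
    define B where "B = (LINT x|lebesgue. g x) / h ^ DIM('a)"
    have AB: "norm (A n x) \<le> B * indicator \<Omega> x" for n x
    proof -
      have "\<bar>LINT y:grid_cell h x|lebesgue. v n y\<bar> \<le> (LINT x|lebesgue. g x)"
        unfolding v_def by (rule set_integral_bound_dominated[OF u g])
      then have "\<bar>cell_average h (v n) x\<bar> \<le> B"
        using h by (simp add: cell_average_def B_def abs_divide divide_right_mono)
      then show ?thesis by (simp add: A_def split: split_indicator)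
    qed
    have "(\<lambda>n. \<integral>\<^sup>+x. ennreal (norm (L x - A n x)) \<partial>lebesgue) \<longlonglongrightarrow> 0"
    proof (rule nn_integral_dominated_convergence_norm[OF Am Lm])
      show "(\<lambda>x. B * indicator \<Omega> x) \<in> borel_measurable lebesgue"
        by (intro borel_measurable_times borel_measurable_const borel_measurable_indicator \<Omega>)
      have "(\<integral>\<^sup>+x. ennreal (B * indicator \<Omega> x) \<partial>lebesgue) = (\<integral>\<^sup>+x. ennreal B * indicator \<Omega> x \<partial>lebesgue)"
        by (intro nn_integral_cong) (auto split: split_indicator)
      then show "(\<integral>\<^sup>+x. ennreal (B * indicator \<Omega> x) \<partial>lebesgue) < \<infinity>"
        using \<Omega> by (simp add: nn_integral_cmult_indicator ennreal_mult_less_top del: emeasure_completion)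
    qed (use AB AL in auto)
    then have "eventually (\<lambda>n. (\<integral>\<^sup>+x. ennreal (norm (L x - A n x)) \<partial>lebesgue) < ennreal (e / 4)) sequentially"
      using e by (intro order_tendstoD) auto
    then obtain N where N: "\<And>n. N \<le> n \<Longrightarrow> (\<integral>\<^sup>+x. ennreal (norm (L x - A n x)) \<partial>lebesgue) < ennreal (e / 4)"
      by (auto simp: eventually_sequentially)
    have "(LINT x|lebesgue. norm (v i x - v j x)) < e" if ij: "N \<le> i" "N \<le> j" for i j
    proof -
      let ?w = "\<lambda>x. v i x - v j x"
      have wi: "integrable lebesgue ?w" using vi by auto
      have off: "AE x in lebesgue. x \<notin> \<Omega> \<longrightarrow> ?w x = 0"
        using u0[of "r i"] u0[of "r j"] by eventually_elim (auto simp: v_def)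
      have "ennreal (LINT x|lebesgue. norm (?w x)) = (\<integral>\<^sup>+x. ennreal (norm (?w x)) \<partial>lebesgue)"
        using wi by (intro nn_integral_eq_integral[symmetric]) auto
      also have "\<dots> = (\<integral>\<^sup>+x\<in>\<Omega>. ennreal \<bar>?w x\<bar> \<partial>lebesgue)"
        using off by (intro nn_integral_cong_AE) (auto elim!: eventually_mono split: split_indicator)
      also have "\<dots> \<le> (\<integral>\<^sup>+x\<in>\<Omega>. ennreal \<bar>cell_average h ?w x\<bar> \<partial>lebesgue) + ennreal \<delta> * emeasure lebesgue \<Omega>
       + ennreal (\<delta> powr (1 - p) * ?n powr (?n + p * s) * h powr (p * s)) * gagliardo_int s p UNIV ?w"
        by (rule L1_le_cell_average[OF h \<delta>(1) p s wi \<Omega>(1)])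
      also have "\<dots> \<le> ennreal (e / 2) + ennreal (e / 8) + ennreal (e / 4)"
      proof (intro add_mono)
        have "(\<integral>\<^sup>+x\<in>\<Omega>. ennreal \<bar>cell_average h ?w x\<bar> \<partial>lebesgue)
            \<le> (\<integral>\<^sup>+x. ennreal (norm (L x - A i x)) + ennreal (norm (L x - A j x)) \<partial>lebesgue)"
        proof (rule nn_integral_mono)
          fix x
          have "ennreal \<bar>cell_average h ?w x\<bar> * indicator \<Omega> x = ennreal \<bar>A i x - A j x\<bar>"
            unfolding cell_average_diff[OF h vi vi] A_def by (auto split: split_indicator)
          also have "\<dots> \<le> ennreal (norm (L x - A i x) + norm (L x - A j x))"
            by (intro ennreal_leI) simp
          finally show "ennreal \<bar>cell_average h ?w x\<bar> * indicator \<Omega> x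
              \<le> ennreal (norm (L x - A i x)) + ennreal (norm (L x - A j x))"
            by simp
        qed
        also have "\<dots> = (\<integral>\<^sup>+x. ennreal (norm (L x - A i x)) \<partial>lebesgue) + (\<integral>\<^sup>+x. ennreal (norm (L x - A j x)) \<partial>lebesgue)"
          by (rule nn_integral_add) (rule LAm)+
        also have "\<dots> \<le> ennreal (e / 4) + ennreal (e / 4)"
          by (intro add_mono less_imp_le N ij)
        also have "\<dots> = ennreal (e / 2)" using e by (simp flip: ennreal_plus)
        finally show "(\<integral>\<^sup>+x\<in>\<Omega>. ennreal \<bar>cell_average h ?w x\<bar> \<partial>lebesgue) \<le> ennreal (e / 2)" .
        show "ennreal \<delta> * emeasure lebesgue \<Omega> \<le> ennreal (e / 8)"
          unfolding m(1) using \<delta> m by (simp add: ennreal_leI flip: ennreal_mult)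
        have "ennreal (c * h powr (p * s)) * gagliardo_int s p UNIV ?w
            \<le> ennreal (c * h powr (p * s)) * ennreal (2 powr p * (2 * \<bar>K\<bar>))"
          by (intro mult_left_mono GD) auto
        also have "\<dots> = ennreal (c * h powr (p * s) * (2 powr p * (2 * \<bar>K\<bar>)))"
          by (rule ennreal_mult[symmetric]) (auto simp: c_def)
        also have "\<dots> \<le> ennreal (e / 4)"
          using j0 by (intro ennreal_leI) (simp add: h_def)
        finally show "ennreal (\<delta> powr (1 - p) * ?n powr (?n + p * s) * h powr (p * s)) * gagliardo_int s p UNIV ?w
            \<le> ennreal (e / 4)"
          by (simp add: c_def)
      qed
      also have "\<dots> = ennreal (7 * e / 8)" using e by (simp flip: ennreal_plus)
      finally have "(LINT x|lebesgue. norm (?w x)) \<le> 7 * e / 8" using e by (simp add: ennreal_le_iff)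
      then show ?thesis using e by simp
    qed
    then show ?thesis by blast
  qed
  obtain r' where r': "strict_mono r'" "AE x in lebesgue. Cauchy (\<lambda>i. v (r' i) x)"
    by (rule cauchy_L1_AE_cauchy_subseq[where s=v and M=lebesgue, OF vi cauchy])
  show ?thesis
  proof (rule that)
    show "strict_mono (r \<circ> r')" using r r'(1) by (rule strict_mono_o)
    show "AE x in lebesgue. Cauchy (\<lambda>n. u ((r \<circ> r') n) x)" using r'(2) by (simp add: v_def)
  qed
qed

section \<open>The operator\<close>

lemma W0_sp_iff:
  fixes \<Omega> :: "'a::euclidean_space set"
  assumes "open \<Omega>"
  shows "u \<in> W0_sp s p \<Omega> \<longleftrightarrow> u \<in> borel_measurable lebesgue \<and>
      (\<integral>\<^sup>+x. ennreal (\<bar>u x\<bar> powr p) \<partial>lebesgue) < \<infinity> \<and> gagliardo_int s p UNIV u < \<infinity> \<and>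
      (AE x in lebesgue. x \<notin> \<Omega> \<longrightarrow> u x = 0)"
  using assms by (auto simp: W0_sp_def W_sp_def lebesgue_on_UNIV_eq AE_restrict_space_iff)

lemma W0_sp_diff:
  fixes \<Omega> :: "'a::euclidean_space set"
  assumes p: "1 \<le> p" and \<Omega>: "open \<Omega>" and u: "u \<in> W0_sp s p \<Omega>" and v: "v \<in> W0_sp s p \<Omega>"
  shows "(\<lambda>x. u x - v x) \<in> W0_sp s p \<Omega>"
proof -
  note u' = u[unfolded W0_sp_iff[OF \<Omega>]] and v' = v[unfolded W0_sp_iff[OF \<Omega>]]
  have um: "u \<in> borel_measurable lebesgue" and vm: "v \<in> borel_measurable lebesgue" using u' v' by auto
  have "integrable lebesgue (\<lambda>x. \<bar>u x\<bar> powr p)" "integrable lebesgue (\<lambda>x. \<bar>- v x\<bar> powr p)"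
    using u' v' um vm by (auto simp: integrable_iff_bounded)
  then have "integrable lebesgue (\<lambda>x. \<bar>u x + - v x\<bar> powr p)"
    using um vm by (intro minkowski(1)[OF p]) auto
  then have "(\<integral>\<^sup>+x. ennreal (\<bar>u x - v x\<bar> powr p) \<partial>lebesgue) < \<infinity>"
    by (simp add: integrable_iff_bounded)
  moreover have "gagliardo_int s p UNIV (\<lambda>x. u x - v x) < \<infinity>"
  proof (rule le_less_trans)
    show "gagliardo_int s p UNIV (\<lambda>x. u x - v x)
        \<le> ennreal (2 powr p) * (gagliardo_int s p UNIV u + gagliardo_int s p UNIV v)"
      using p um vm by (intro gagliardo_int_diff_le) auto
  qed (use u' v' in \<open>simp add: ennreal_mult_less_top\<close>)
  moreover have "AE x in lebesgue. x \<notin> \<Omega> \<longrightarrow> u x - v x = 0"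
  proof -
    have "AE x in lebesgue. x \<notin> \<Omega> \<longrightarrow> u x = 0" "AE x in lebesgue. x \<notin> \<Omega> \<longrightarrow> v x = 0" using u' v' by auto
    then show ?thesis by eventually_elim auto
  qed
  ultimately show ?thesis using um vm by (simp add: W0_sp_iff[OF \<Omega>])
qed

lemma frac_p_laplacian_integrable:
  fixes u v :: "'a::euclidean_space \<Rightarrow> real"
  assumes p: "1 \<le> p"
    and u: "u \<in> borel_measurable lebesgue" "gagliardo_int s p UNIV u < \<infinity>"
    and v: "v \<in> borel_measurable lebesgue" "gagliardo_int s p UNIV v < \<infinity>"
  shows "integrable (frac_measure s p)
    (\<lambda>z. \<bar>u (fst z) - u (snd z)\<bar> powr (p - 2) * (u (fst z) - u (snd z)) * (v (fst z) - v (snd z)))"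
proof (rule Bochner_Integration.integrable_bound)
  note gu = gagliardo_seminorm_integral[OF u(1), where s=s and p=p]
  note gv = gagliardo_seminorm_integral[OF v(1), where s=s and p=p]
  note [measurable] = gu(1) gv(1)
  show "integrable (frac_measure s p)
      (\<lambda>z. \<bar>u (fst z) - u (snd z)\<bar> powr p + \<bar>v (fst z) - v (snd z)\<bar> powr p)"
    using gu(2) gv(2) u(2) v(2) by auto
  show "(\<lambda>z. \<bar>u (fst z) - u (snd z)\<bar> powr (p - 2) * (u (fst z) - u (snd z)) * (v (fst z) - v (snd z)))
      \<in> borel_measurable (frac_measure s p)"
    by measurable
  show "AE z in frac_measure s p.
      norm (\<bar>u (fst z) - u (snd z)\<bar> powr (p - 2) * (u (fst z) - u (snd z)) * (v (fst z) - v (snd z)))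
        \<le> norm (\<bar>u (fst z) - u (snd z)\<bar> powr p + \<bar>v (fst z) - v (snd z)\<bar> powr p)"
    using p_laplacian_integrand_bound[OF p] by (intro AE_I2) (simp add: add_increasing)
qed

lemma gagliardo_int_eq_frac_p_laplacian:
  fixes u :: "'a::euclidean_space \<Rightarrow> real"
  assumes p: "0 < p" and u: "u \<in> borel_measurable lebesgue" "gagliardo_int s p UNIV u < \<infinity>"
  shows "gagliardo_int s p UNIV u = ennreal (frac_p_laplacian s p u u)"
proof -
  note gu = gagliardo_seminorm_integral[OF u(1), where s=s and p=p]
  have sq: "\<bar>a\<bar> powr (p - 2) * a * a = \<bar>a\<bar> powr p" for a :: real
    using p by (cases "a = 0") (simp_all add: powr_diff power2_eq_square)
  have "gagliardo_int s p UNIV u = (\<integral>\<^sup>+z. ennreal (\<bar>u (fst z) - u (snd z)\<bar> powr p) \<partial>frac_measure s p)"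
    by (simp add: gagliardo_int_def)
  also have "\<dots> = ennreal (LINT z|frac_measure s p. \<bar>u (fst z) - u (snd z)\<bar> powr p)"
    using gu(2) u(2) by (intro nn_integral_eq_integral) auto
  finally show ?thesis by (simp add: frac_p_laplacian_def sq)
qed

lemma frac_p_laplacian_strongly_monotone:
  fixes u v :: "'a::euclidean_space \<Rightarrow> real"
  assumes p: "2 \<le> p"
    and u: "u \<in> borel_measurable lebesgue" "gagliardo_int s p UNIV u < \<infinity>"
    and v: "v \<in> borel_measurable lebesgue" "gagliardo_int s p UNIV v < \<infinity>"
  defines "w \<equiv> \<lambda>x. u x - v x"
  shows "gagliardo_int s p UNIV w
    \<le> ennreal (2 powr (p - 1) * (frac_p_laplacian s p u w - frac_p_laplacian s p v w))"
proof -
  let ?M = "frac_measure s p :: ('a \<times> 'a) measure"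
  let ?\<phi> = "\<lambda>a::real. \<bar>a\<bar> powr (p - 2) * a"
  have w: "w \<in> borel_measurable lebesgue" using u(1) v(1) by (simp add: w_def)
  have "gagliardo_int s p UNIV w
      \<le> ennreal (2 powr p) * (gagliardo_int s p UNIV u + gagliardo_int s p UNIV v)"
    unfolding w_def using p u(1) v(1) by (intro gagliardo_int_diff_le) auto
  also have "\<dots> < \<infinity>" using u(2) v(2) by (simp add: ennreal_mult_less_top)
  finally have gw: "gagliardo_int s p UNIV w < \<infinity>" .
  have iu: "integrable ?M (\<lambda>z. ?\<phi> (u (fst z) - u (snd z)) * (w (fst z) - w (snd z)))"
    using p u w gw by (intro frac_p_laplacian_integrable) auto
  have iv: "integrable ?M (\<lambda>z. ?\<phi> (v (fst z) - v (snd z)) * (w (fst z) - w (snd z)))"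
    using p v w gw by (intro frac_p_laplacian_integrable) auto
  have "gagliardo_int s p UNIV w = (\<integral>\<^sup>+z. ennreal (\<bar>w (fst z) - w (snd z)\<bar> powr p) \<partial>?M)"
    by (simp add: gagliardo_int_def)
  also have "\<dots> \<le> (\<integral>\<^sup>+z. ennreal (2 powr (p - 1) * (?\<phi> (u (fst z) - u (snd z)) * (w (fst z) - w (snd z))
        - ?\<phi> (v (fst z) - v (snd z)) * (w (fst z) - w (snd z)))) \<partial>?M)"
  proof (intro nn_integral_mono ennreal_leI)
    fix z :: "'a \<times> 'a"
    let ?a = "u (fst z) - u (snd z)" and ?b = "v (fst z) - v (snd z)"
    have "2 powr (p - 1) * (2 powr (1 - p) * \<bar>?a - ?b\<bar> powr p) \<le> 2 powr (p - 1) * ((?\<phi> ?a - ?\<phi> ?b) * (?a - ?b))"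
      using p by (intro mult_left_mono strongly_monotone_powr) auto
    moreover have "2 powr (p - 1) * 2 powr (1 - p) = (1::real)" by (simp flip: powr_add)
    moreover have "w (fst z) - w (snd z) = ?a - ?b" by (simp add: w_def)
    ultimately show "\<bar>w (fst z) - w (snd z)\<bar> powr p
        \<le> 2 powr (p - 1) * (?\<phi> ?a * (w (fst z) - w (snd z)) - ?\<phi> ?b * (w (fst z) - w (snd z)))"
      by (simp only: mult.assoc[symmetric] mult_1 left_diff_distrib[symmetric])
  qed
  also have "\<dots> = ennreal (LINT z|?M. 2 powr (p - 1) * (?\<phi> (u (fst z) - u (snd z)) * (w (fst z) - w (snd z))
        - ?\<phi> (v (fst z) - v (snd z)) * (w (fst z) - w (snd z))))"
  proof (rule nn_integral_eq_integral)
    show "AE z in ?M. 0 \<le> 2 powr (p - 1) * (?\<phi> (u (fst z) - u (snd z)) * (w (fst z) - w (snd z))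
        - ?\<phi> (v (fst z) - v (snd z)) * (w (fst z) - w (snd z)))"
    proof (rule AE_I2)
      fix z :: "'a \<times> 'a"
      let ?a = "u (fst z) - u (snd z)" and ?b = "v (fst z) - v (snd z)"
      have "0 \<le> (?\<phi> ?a - ?\<phi> ?b) * (?a - ?b)"
        by (rule order_trans[OF _ strongly_monotone_powr[OF p]]) simp
      moreover have "w (fst z) - w (snd z) = ?a - ?b" by (simp add: w_def)
      ultimately show "0 \<le> 2 powr (p - 1) * (?\<phi> ?a * (w (fst z) - w (snd z)) - ?\<phi> ?b * (w (fst z) - w (snd z)))"
        by (simp only: left_diff_distrib[symmetric] mult_nonneg_nonneg powr_ge_zero)
    qed
  qed (use iu iv in simp)
  also have "(LINT z|?M. 2 powr (p - 1) * (?\<phi> (u (fst z) - u (snd z)) * (w (fst z) - w (snd z))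
        - ?\<phi> (v (fst z) - v (snd z)) * (w (fst z) - w (snd z))))
      = 2 powr (p - 1) * (frac_p_laplacian s p u w - frac_p_laplacian s p v w)"
    using iu iv by (simp add: frac_p_laplacian_def)
  finally show ?thesis .
qed

text \<open>
  Summability of \<open>[u n - l]^p\<close> produces one integrable majorant for all the integrands,
  namely the sum of the series of \<open>p\<close>-th powers of the differences. A norm convergent sequence has a
  subsequence of this kind, which is enough to identify the limit.
\<close>

lemma frac_p_laplacian_tendsto:
  fixes u :: "nat \<Rightarrow> 'a::euclidean_space \<Rightarrow> real"
  assumes p: "1 < p" and u: "\<And>n. u n \<in> borel_measurable lebesgue"
    and l: "l \<in> borel_measurable lebesgue" "gagliardo_int s p UNIV l < \<infinity>"
    and v: "v \<in> borel_measurable lebesgue" "gagliardo_int s p UNIV v < \<infinity>"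
    and lim: "AE x in lebesgue. (\<lambda>n. u n x) \<longlonglongrightarrow> l x"
    and fast: "(\<Sum>n. gagliardo_int s p UNIV (\<lambda>x. u n x - l x)) < \<infinity>"
  shows "(\<lambda>n. frac_p_laplacian s p (u n) v) \<longlonglongrightarrow> frac_p_laplacian s p l v"
proof -
  let ?M = "frac_measure s p :: ('a \<times> 'a) measure"
  let ?\<phi> = "\<lambda>a::real. \<bar>a\<bar> powr (p - 2) * a"
  define U where "U n z = u n (fst z) - u n (snd z)" for n and z :: "'a \<times> 'a"
  define L where "L z = l (fst z) - l (snd z)" for z :: "'a \<times> 'a"
  define V where "V z = v (fst z) - v (snd z)" for z :: "'a \<times> 'a"
  have Um: "U n \<in> borel_measurable ?M" for n
    unfolding U_def[abs_def] by (rule gagliardo_seminorm_integral(1)[OF u])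
  have Lm: "L \<in> borel_measurable ?M" and Vm: "V \<in> borel_measurable ?M"
    unfolding L_def[abs_def] V_def[abs_def]
    by (rule gagliardo_seminorm_integral(1)[OF l(1)], rule gagliardo_seminorm_integral(1)[OF v(1)])
  note [measurable] = Um Lm Vm
  have Li: "integrable ?M (\<lambda>z. \<bar>L z\<bar> powr p)" and Vi: "integrable ?M (\<lambda>z. \<bar>V z\<bar> powr p)"
    using gagliardo_seminorm_integral(2)[OF l(1), of s p] gagliardo_seminorm_integral(2)[OF v(1), of s p] l(2) v(2)
    by (simp_all add: L_def V_def)
  define S where "S z = (\<Sum>n. ennreal (\<bar>U n z - L z\<bar> powr p))" for z
  have Sm [measurable]: "S \<in> borel_measurable ?M" unfolding S_def[abs_def] by measurable
  have "(\<integral>\<^sup>+z. S z \<partial>?M) = (\<Sum>n. \<integral>\<^sup>+z. ennreal (\<bar>U n z - L z\<bar> powr p) \<partial>?M)"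
    unfolding S_def by (rule nn_integral_suminf) measurable
  also have "\<dots> = (\<Sum>n. gagliardo_int s p UNIV (\<lambda>x. u n x - l x))"
    by (simp add: gagliardo_int_def U_def L_def algebra_simps)
  finally have Sint: "(\<integral>\<^sup>+z. S z \<partial>?M) < \<infinity>" using fast by simp
  then have Sfin: "AE z in ?M. S z \<noteq> \<infinity>"
    by (intro nn_integral_PInf_AE) auto
  have Si: "integrable ?M (\<lambda>z. enn2real (S z))"
  proof (rule integrableI_nonneg)
    have "(\<integral>\<^sup>+z. ennreal (enn2real (S z)) \<partial>?M) \<le> (\<integral>\<^sup>+z. S z \<partial>?M)"
      by (intro nn_integral_mono) (simp add: ennreal_enn2real_if)
    then show "(\<integral>\<^sup>+z. ennreal (enn2real (S z)) \<partial>?M) < \<infinity>" using Sint by simp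
  qed auto
  have term_le: "F n \<le> (\<Sum>m. F m)" for F :: "nat \<Rightarrow> ennreal" and n
    using sum_le_suminf[OF summableI, of "{n}" F] by simp
  have "(\<lambda>n. LINT z|?M. ?\<phi> (U n z) * V z) \<longlonglongrightarrow> (LINT z|?M. ?\<phi> (L z) * V z)"
  proof (rule integral_dominated_convergence)
    show "integrable ?M (\<lambda>z. 2 powr p * (enn2real (S z) + \<bar>L z\<bar> powr p) + \<bar>V z\<bar> powr p)"
      using Si Li Vi by simp
    show "AE z in ?M. (\<lambda>n. ?\<phi> (U n z) * V z) \<longlonglongrightarrow> ?\<phi> (L z) * V z"
      using AE_fst_snd[OF lim, of s p]
    proof eventually_elim
      case (elim z)
      then have "(\<lambda>n. U n z) \<longlonglongrightarrow> L z" unfolding U_def L_def by (intro tendsto_diff) auto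
      then have "(\<lambda>n. ?\<phi> (U n z)) \<longlonglongrightarrow> ?\<phi> (L z)"
        by (rule isCont_tendsto_compose[OF isCont_signed_powr[OF p]])
      then show ?case by (rule tendsto_mult[OF _ tendsto_const])
    qed
    show "AE z in ?M. norm (?\<phi> (U n z) * V z) \<le> 2 powr p * (enn2real (S z) + \<bar>L z\<bar> powr p) + \<bar>V z\<bar> powr p" for n
      using Sfin
    proof eventually_elim
      case (elim z)
      have "ennreal (\<bar>U n z - L z\<bar> powr p) \<le> S z"
        unfolding S_def by (rule term_le)
      also have "S z = ennreal (enn2real (S z))"
        using elim by (intro ennreal_enn2real[symmetric]) (simp only: infinity_ennreal_def top.not_eq_extremum)
      finally have le: "\<bar>U n z - L z\<bar> powr p \<le> enn2real (S z)" by (simp add: ennreal_le_iff)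
      have "\<bar>U n z\<bar> powr p \<le> (\<bar>U n z - L z\<bar> + \<bar>L z\<bar>) powr p" using p by (intro powr_mono2) auto
      also have "\<dots> \<le> 2 powr p * (\<bar>U n z - L z\<bar> powr p + \<bar>L z\<bar> powr p)"
        using p by (intro powr_add_le) auto
      also have "\<dots> \<le> 2 powr p * (enn2real (S z) + \<bar>L z\<bar> powr p)"
        using le by (intro mult_left_mono) auto
      finally show ?case using p_laplacian_integrand_bound[of p "U n z" "V z"] p by simp
    qed
  qed measurable
  then show ?thesis by (simp add: frac_p_laplacian_def U_def L_def V_def)
qed

section \<open>The source term\<close>

text \<open>
  For a simple function \<open>u\<close> the composition is pieced together from finitely many sections \<open>f(., t)\<close>; the general case
  follows by continuity in the second variable and completeness of Lebesgue measure.
\<close>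

lemma caratheodory_comp_measurable:
  fixes \<Omega> :: "'a::euclidean_space set"
  assumes f: "caratheodory \<Omega> f" and \<Omega>: "\<Omega> \<in> sets lebesgue" and u: "u \<in> borel_measurable lebesgue"
  shows "(\<lambda>x. indicator \<Omega> x * f x (u x)) \<in> borel_measurable lebesgue"
proof -
  have um: "u \<in> borel_measurable (lebesgue_on \<Omega>)"
    using u by (rule measurable_restrict_space1)
  obtain S where S: "\<And>i. simple_function (lebesgue_on \<Omega>) (S i)"
    "\<And>x. x \<in> space (lebesgue_on \<Omega>) \<Longrightarrow> (\<lambda>i. S i x) \<longlonglongrightarrow> u x"
    using borel_measurable_implies_sequence_metric[OF um, of 0] by metis
  have Sm: "(\<lambda>x. f x (S i x)) \<in> borel_measurable (lebesgue_on \<Omega>)" for i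
  proof (rule measurable_compose_countable'[where f = "\<lambda>t x. f x t" and g = "S i" and I = "S i ` space (lebesgue_on \<Omega>)"])
    show "(\<lambda>x. f x t) \<in> borel_measurable (lebesgue_on \<Omega>)" for t
      using f by (simp add: caratheodory_def)
    show "S i \<in> lebesgue_on \<Omega> \<rightarrow>\<^sub>M count_space (S i ` space (lebesgue_on \<Omega>))"
    proof (rule measurable_count_space_eq2[THEN iffD2])
      show fin: "finite (S i ` space (lebesgue_on \<Omega>))" using S(1)[of i] by (simp add: simple_function_def)
      show "S i \<in> space (lebesgue_on \<Omega>) \<rightarrow> S i ` space (lebesgue_on \<Omega>) \<and>
          (\<forall>a\<in>S i ` space (lebesgue_on \<Omega>). S i -` {a} \<inter> space (lebesgue_on \<Omega>) \<in> sets (lebesgue_on \<Omega>))"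
        using S(1)[of i] by (auto simp: simple_function_def)
    qed
    show "countable (S i ` space (lebesgue_on \<Omega>))"
      using S(1)[of i] by (auto simp: simple_function_def intro: countable_finite)
  qed
  have "(\<lambda>x. lim (\<lambda>i. f x (S i x))) \<in> borel_measurable (lebesgue_on \<Omega>)"
    by (rule borel_measurable_lim_metric) (rule Sm)
  then have "(\<lambda>x. indicator \<Omega> x *\<^sub>R lim (\<lambda>i. f x (S i x))) \<in> borel_measurable lebesgue"
    using \<Omega> by (subst (asm) borel_measurable_restrict_space_iff) auto
  moreover have "AE x in lebesgue. indicator \<Omega> x *\<^sub>R lim (\<lambda>i. f x (S i x)) = indicator \<Omega> x * f x (u x)"
  proof -
    have "AE x in lebesgue. x \<in> \<Omega> \<longrightarrow> continuous_on UNIV (f x)"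
      using f \<Omega> by (simp add: caratheodory_def AE_restrict_space_iff)
    then show ?thesis
    proof eventually_elim
      case (elim x)
      show ?case
      proof (cases "x \<in> \<Omega>")
        case True
        then have "(\<lambda>i. S i x) \<longlonglongrightarrow> u x" by (intro S(2)) simp
        then have "(\<lambda>i. f x (S i x)) \<longlonglongrightarrow> f x (u x)"
          using elim True by (intro continuous_on_tendsto_compose[of UNIV "f x"]) auto
        then show ?thesis by (simp add: limI)
      qed simp
    qed
  qed
  ultimately show ?thesis by (rule borel_measurable_AE)
qed

text \<open>
  The weight \<open>1 + g powr (q - 1)\<close> dominates \<open>f x (u x)\<close> uniformly over all \<open>u\<close> with
  \<open>|u| \<le> g\<close>, so the right-hand side sees only how close to \<open>0\<close> the test function is.
\<close>

lemma source_pairing_bound: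
  fixes \<Omega> :: "'a::euclidean_space set"
  assumes \<Omega>: "\<Omega> \<in> sets lebesgue" and q: "1 \<le> q"
    and growth: "AE x in lebesgue_on \<Omega>. \<forall>t. \<bar>f x t\<bar> \<le> c0 * (1 + \<bar>t\<bar> powr (q - 1))" and c0: "0 \<le> c0"
    and u: "AE x in lebesgue. \<bar>u x\<bar> \<le> g x"
    and int: "integrable lebesgue (\<lambda>x. indicator \<Omega> x * ((1 + g x powr (q - 1)) * \<bar>w x\<bar>))"
  shows "AE x in lebesgue. norm (indicator \<Omega> x *\<^sub>R (f x (u x) * w x))
           \<le> c0 * (indicator \<Omega> x * ((1 + g x powr (q - 1)) * \<bar>w x\<bar>))"
    and "\<bar>LINT x:\<Omega>|lebesgue. f x (u x) * w x\<bar>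
           \<le> c0 * (LINT x|lebesgue. indicator \<Omega> x * ((1 + g x powr (q - 1)) * \<bar>w x\<bar>))"
proof -
  have "AE x in lebesgue. x \<in> \<Omega> \<longrightarrow> (\<forall>t. \<bar>f x t\<bar> \<le> c0 * (1 + \<bar>t\<bar> powr (q - 1)))"
    using growth \<Omega> by (simp add: AE_restrict_space_iff)
  then show le: "AE x in lebesgue. norm (indicator \<Omega> x *\<^sub>R (f x (u x) * w x))
           \<le> c0 * (indicator \<Omega> x * ((1 + g x powr (q - 1)) * \<bar>w x\<bar>))"
    using u
  proof eventually_elim
    case (elim x)
    show ?case
    proof (cases "x \<in> \<Omega>")
      case True
      have "\<bar>f x (u x)\<bar> \<le> c0 * (1 + \<bar>u x\<bar> powr (q - 1))" using elim True by blast
      also have "\<dots> \<le> c0 * (1 + g x powr (q - 1))"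
        using elim q c0 by (intro mult_left_mono add_left_mono powr_mono2) auto
      finally have "\<bar>f x (u x)\<bar> * \<bar>w x\<bar> \<le> c0 * (1 + g x powr (q - 1)) * \<bar>w x\<bar>"
        by (rule mult_right_mono) simp
      then show ?thesis using True by (simp add: abs_mult mult.assoc)
    qed simp
  qed
  have "\<bar>LINT x:\<Omega>|lebesgue. f x (u x) * w x\<bar> \<le> (LINT x|lebesgue. norm (indicator \<Omega> x *\<^sub>R (f x (u x) * w x)))"
    unfolding set_lebesgue_integral_def using integral_norm_bound by force
  also have "\<dots> \<le> (LINT x|lebesgue. c0 * (indicator \<Omega> x * ((1 + g x powr (q - 1)) * \<bar>w x\<bar>)))"
    using le int by (intro integral_mono_AE') auto
  finally show "\<bar>LINT x:\<Omega>|lebesgue. f x (u x) * w x\<bar>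
           \<le> c0 * (LINT x|lebesgue. indicator \<Omega> x * ((1 + g x powr (q - 1)) * \<bar>w x\<bar>))"
    by simp
qed

lemma source_pairing_tendsto:
  fixes \<Omega> :: "'a::euclidean_space set"
  assumes f: "caratheodory \<Omega> f" and \<Omega>: "\<Omega> \<in> sets lebesgue" and q: "1 \<le> q"
    and growth: "AE x in lebesgue_on \<Omega>. \<forall>t. \<bar>f x t\<bar> \<le> c0 * (1 + \<bar>t\<bar> powr (q - 1))" and c0: "0 \<le> c0"
    and u: "\<And>n. u n \<in> borel_measurable lebesgue" "\<And>n. AE x in lebesgue. \<bar>u n x\<bar> \<le> g x"
    and l: "l \<in> borel_measurable lebesgue" "AE x in lebesgue. (\<lambda>n. u n x) \<longlonglongrightarrow> l x"
    and w: "w \<in> borel_measurable lebesgue"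
    and int: "integrable lebesgue (\<lambda>x. indicator \<Omega> x * ((1 + g x powr (q - 1)) * \<bar>w x\<bar>))"
  shows "(\<lambda>n. LINT x:\<Omega>|lebesgue. f x (u n x) * w x) \<longlonglongrightarrow> (LINT x:\<Omega>|lebesgue. f x (l x) * w x)"
  unfolding set_lebesgue_integral_def
proof (rule integral_dominated_convergence)
  have meas: "(\<lambda>x. indicator \<Omega> x *\<^sub>R (f x (v x) * w x)) \<in> borel_measurable lebesgue"
    if v: "v \<in> borel_measurable lebesgue" for v
    using borel_measurable_times[OF caratheodory_comp_measurable[OF f \<Omega> v] w] by (simp add: mult.assoc)
  show "(\<lambda>x. indicator \<Omega> x *\<^sub>R (f x (l x) * w x)) \<in> borel_measurable lebesgue" by (rule meas[OF l(1)])
  show "(\<lambda>x. indicator \<Omega> x *\<^sub>R (f x (u n x) * w x)) \<in> borel_measurable lebesgue" for n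
    by (rule meas[OF u(1)])
  show "integrable lebesgue (\<lambda>x. c0 * (indicator \<Omega> x * ((1 + g x powr (q - 1)) * \<bar>w x\<bar>)))"
    using int by simp
  show "AE x in lebesgue. norm (indicator \<Omega> x *\<^sub>R (f x (u n x) * w x))
      \<le> c0 * (indicator \<Omega> x * ((1 + g x powr (q - 1)) * \<bar>w x\<bar>))" for n
    by (rule source_pairing_bound(1)[OF \<Omega> q growth c0 u(2) int])
  have "AE x in lebesgue. x \<in> \<Omega> \<longrightarrow> continuous_on UNIV (f x)"
    using f \<Omega> by (simp add: caratheodory_def AE_restrict_space_iff)
  then show "AE x in lebesgue. (\<lambda>n. indicator \<Omega> x *\<^sub>R (f x (u n x) * w x)) \<longlonglongrightarrow> indicator \<Omega> x *\<^sub>R (f x (l x) * w x)"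
    using l(2)
  proof eventually_elim
    case (elim x)
    show ?case
    proof (cases "x \<in> \<Omega>")
      case True
      then have "(\<lambda>n. f x (u n x)) \<longlonglongrightarrow> f x (l x)"
        using elim by (intro continuous_on_tendsto_compose[of UNIV "f x"]) auto
      then show ?thesis by (intro tendsto_scaleR tendsto_mult tendsto_const)
    qed simp
  qed
qed

section \<open>Compactness of the set of solutions\<close>

text \<open>
  Sequential compactness in terms of representatives. A limit \<open>l\<close> is obtained pointwise from
  \<open>rellich_dominated\<close>; monotonicity and Fatou's lemma upgrade the convergence to the seminorm, and a rapidly
  convergent subsequence shows that \<open>l\<close> solves the equation.
\<close>

lemma solution_sequence_subconverges:
  fixes \<Omega> :: "'a::euclidean_space set"
  assumes p: "2 \<le> p" and s: "0 < s" and ps: "p * s < real DIM('a)"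
    and \<Omega>: "open \<Omega>" "bounded \<Omega>"
    and f: "caratheodory \<Omega> f" and c0: "0 \<le> c0"
    and q: "p < q" "q < p_star TYPE('a) s p"
    and growth: "AE x in lebesgue_on \<Omega>. \<forall>t. \<bar>f x t\<bar> \<le> c0 * (1 + \<bar>t\<bar> powr (q - 1))"
    and ul: "ul \<in> W_tilde s p \<Omega>" and uu: "uu \<in> W_tilde s p \<Omega>"
    and \<sigma>: "\<And>n. \<sigma> n \<in> solution_set s p \<Omega> f ul uu"
  obtains r l where "strict_mono (r :: nat \<Rightarrow> nat)" "l \<in> solution_set s p \<Omega> f ul uu"
    "(\<lambda>n. gagliardo_seminorm s p (\<lambda>x. \<sigma> (r n) x - l x)) \<longlonglongrightarrow> 0"
proof -
  have p0: "0 < p" "1 < p" "1 \<le> p" "0 \<le> p" and q1: "1 \<le> q" "0 \<le> q" using p q by auto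
  have \<Omega>m: "\<Omega> \<in> sets lebesgue" using \<Omega> by simp
  have \<Omega>fin: "emeasure lebesgue \<Omega> < \<infinity>"
    using fmeasurableD2[OF bounded_set_imp_lmeasurable[OF \<Omega>(2) \<Omega>m]]
    by (simp only: infinity_ennreal_def top.not_eq_extremum)
  have one: "integrable lebesgue (indicator \<Omega> :: 'a \<Rightarrow> real)"
    by (rule integrable_real_indicator[OF \<Omega>m \<Omega>fin])

  define g where "g x = indicator \<Omega> x * (\<bar>ul x\<bar> + \<bar>uu x\<bar>)" for x
  have ulm: "ul \<in> borel_measurable lebesgue" and uum: "uu \<in> borel_measurable lebesgue"
    using ul uu by (auto simp: W_tilde_def Lp_loc_def)
  have gm: "g \<in> borel_measurable lebesgue"
    unfolding g_def[abs_def] using ulm uum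
    by (intro borel_measurable_times borel_measurable_indicator \<Omega>m borel_measurable_add borel_measurable_abs)
  have g0: "0 \<le> g x" for x by (simp add: g_def)
  have Lq: "integrable lebesgue (\<lambda>x. indicator \<Omega> x * \<bar>u x\<bar> powr q)" if u: "u \<in> W_tilde s p \<Omega>" for u
  proof -
    obtain U where "open U" "closure \<Omega> \<subseteq> U" "u \<in> W_sp s p U" "u \<in> borel_measurable lebesgue"
      using u by (auto simp: W_tilde_def Lp_loc_def)
    then show ?thesis using \<Omega> \<Omega>m p0 s ps q q1 by (intro W_sp_Lq_integrable) auto
  qed
  have gq: "integrable lebesgue (\<lambda>x. g x powr q)"
  proof (rule Bochner_Integration.integrable_bound)
    show "integrable lebesgue (\<lambda>x. 2 powr q * (indicator \<Omega> x * \<bar>ul x\<bar> powr q + indicator \<Omega> x * \<bar>uu x\<bar> powr q))"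
      using Lq[OF ul] Lq[OF uu] by simp
    show "(\<lambda>x. g x powr q) \<in> borel_measurable lebesgue" using gm by measurable
    show "AE x in lebesgue. norm (g x powr q)
        \<le> norm (2 powr q * (indicator \<Omega> x * \<bar>ul x\<bar> powr q + indicator \<Omega> x * \<bar>uu x\<bar> powr q))"
      using powr_add_le[OF q1(2)] q1 by (intro AE_I2) (auto simp: g_def split: split_indicator)
  qed

  \<comment> \<open>A single integrable majorant: \<open>H\<close> dominates \<open>g\<close>, \<open>g powr p\<close>
    and, up to a constant, every integrand of the source term.\<close>
  define H where "H x = indicator \<Omega> x + g x powr q" for x
  have Hi: "integrable lebesgue H" unfolding H_def[abs_def] using one gq by simp
  have H0: "0 \<le> H x" for x by (simp add: H_def)
  have tq: "t \<le> 1 + t powr q" "t powr p \<le> 1 + t powr q" if "0 \<le> t" for t :: real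
  proof -
    have "t powr e \<le> 1 + t powr q" if e: "0 \<le> e" "e \<le> q" for e
    proof (cases "t \<le> 1")
      case True
      then have "t powr e \<le> 1" using \<open>0 \<le> t\<close> e by (intro powr_le1) auto
      then show ?thesis by (simp add: add_increasing2)
    next
      case False
      then have "t powr e \<le> t powr q" using e by (intro powr_mono) auto
      then show ?thesis by simp
    qed
    from this[of 1] this[of p] show "t \<le> 1 + t powr q" "t powr p \<le> 1 + t powr q"
      using that p q by auto
  qed
  have gH: "g x \<le> H x" "g x powr p \<le> H x" for x
    using tq[OF g0, of x] p0 by (auto simp: H_def g_def split: split_indicator)
  have gi: "integrable lebesgue g"
    by (rule Bochner_Integration.integrable_bound[OF Hi gm]) (use gH(1) g0 H0 in \<open>auto intro!: AE_I2\<close>)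

  let ?m = "\<lambda>w x. indicator \<Omega> x * ((1 + g x powr (q - 1)) * \<bar>w x\<bar>)"
  have mm: "?m w \<in> borel_measurable lebesgue" if w: "w \<in> borel_measurable lebesgue" for w
  proof -
    have "(\<lambda>x. (1 + g x powr (q - 1)) * \<bar>w x\<bar>) \<in> borel_measurable lebesgue" using gm w by measurable
    then show ?thesis by (rule borel_measurable_times[OF borel_measurable_indicator[OF \<Omega>m]])
  qed
  have mle: "?m w x \<le> 4 * H x" if "\<bar>w x\<bar> \<le> 2 * g x" for w x
  proof -
    have "(1 + g x powr (q - 1)) * \<bar>w x\<bar> \<le> (1 + g x powr (q - 1)) * (2 * g x)"
      using that by (intro mult_left_mono) (auto simp: add_nonneg_nonneg)
    also have "\<dots> = 2 * g x + 2 * g x powr q"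
      using powr_mult_base[OF g0, of x "q - 1"] by (simp add: algebra_simps)
    finally show ?thesis using gH(1)[of x] H0[of x] by (auto simp: H_def split: split_indicator)
  qed
  have mi: "integrable lebesgue (?m w)"
    if w: "w \<in> borel_measurable lebesgue" "AE x in lebesgue. \<bar>w x\<bar> \<le> 2 * g x" for w
  proof (rule Bochner_Integration.integrable_bound[OF _ mm[OF w(1)]])
    show "integrable lebesgue (\<lambda>x. 4 * H x)" using Hi by simp
    show "AE x in lebesgue. norm (?m w x) \<le> norm (4 * H x)"
      using w(2)
    proof eventually_elim
      case (elim x)
      have "0 \<le> ?m w x" by (simp add: add_nonneg_nonneg)
      then show ?case using mle[of w x, OF elim] by simp
    qed
  qed

  have S: "u \<in> W0_sp s p \<Omega>" "\<And>v. v \<in> W0_sp s p \<Omega> \<Longrightarrow> frac_p_laplacian s p u v = (LINT x:\<Omega>|lebesgue. f x (u x) * v x)"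
      "AE x in lebesgue. ul x \<le> u x \<and> u x \<le> uu x"
      "u \<in> borel_measurable lebesgue" "gagliardo_int s p UNIV u < \<infinity>" "AE x in lebesgue. x \<notin> \<Omega> \<longrightarrow> u x = 0"
    if "u \<in> solution_set s p \<Omega> f ul uu" for u
  proof -
    show uW: "u \<in> W0_sp s p \<Omega>" and "AE x in lebesgue. ul x \<le> u x \<and> u x \<le> uu x"
      using that by (simp_all add: solution_set_def)
    show "frac_p_laplacian s p u v = (LINT x:\<Omega>|lebesgue. f x (u x) * v x)" if "v \<in> W0_sp s p \<Omega>" for v
      using \<open>u \<in> solution_set s p \<Omega> f ul uu\<close> that by (simp add: solution_set_def solution_def)
    show "u \<in> borel_measurable lebesgue" "gagliardo_int s p UNIV u < \<infinity>" "AE x in lebesgue. x \<notin> \<Omega> \<longrightarrow> u x = 0"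
      using uW by (simp_all add: W0_sp_iff[OF \<Omega>(1)])
  qed
  have Sg: "AE x in lebesgue. \<bar>u x\<bar> \<le> g x" if u: "u \<in> solution_set s p \<Omega> f ul uu" for u
    using S(3)[OF u] S(6)[OF u] by eventually_elim (auto simp: g_def split: split_indicator)

  define K where "K = c0 * (LINT x|lebesgue. ?m g x)"
  \<comment> \<open>The solution is its own test function.\<close>
  have K: "gagliardo_int s p UNIV (\<sigma> n) \<le> ennreal K" for n
  proof -
    have "gagliardo_int s p UNIV (\<sigma> n) = ennreal (frac_p_laplacian s p (\<sigma> n) (\<sigma> n))"
      using S[OF \<sigma>] p0 by (intro gagliardo_int_eq_frac_p_laplacian) auto
    also have "frac_p_laplacian s p (\<sigma> n) (\<sigma> n) = (LINT x:\<Omega>|lebesgue. f x (\<sigma> n x) * \<sigma> n x)"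
      using S(1,2)[OF \<sigma>] by blast
    also have "\<dots> \<le> c0 * (LINT x|lebesgue. ?m (\<sigma> n) x)"
    proof -
      have "AE x in lebesgue. \<bar>\<sigma> n x\<bar> \<le> 2 * g x"
        using Sg[OF \<sigma>[of n]] by eventually_elim (use g0 in \<open>smt (verit)\<close>)
      then have "integrable lebesgue (?m (\<sigma> n))" by (rule mi[OF S(4)[OF \<sigma>]])
      from source_pairing_bound(2)[OF \<Omega>m q1(1) growth c0 Sg[OF \<sigma>[of n]] this] show ?thesis by linarith
    qed
    also have "\<dots> \<le> K"
      unfolding K_def
    proof (intro mult_left_mono c0 integral_mono_AE')
      show "integrable lebesgue (?m g)" using gm g0 by (intro mi) auto
      show "AE x in lebesgue. ?m (\<sigma> n) x \<le> ?m g x"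
        using Sg[OF \<sigma>[of n]]
        by eventually_elim (auto intro!: mult_left_mono add_nonneg_nonneg)
      show "AE x in lebesgue. 0 \<le> ?m g x" by (auto intro!: AE_I2 add_nonneg_nonneg mult_nonneg_nonneg)
    qed
    finally show ?thesis by (simp add: ennreal_leI)
  qed

  obtain r where r: "strict_mono (r :: nat \<Rightarrow> nat)" "AE x in lebesgue. Cauchy (\<lambda>n. \<sigma> (r n) x)"
    by (rule rellich_dominated[where u = \<sigma> and g = g and K = K, OF p0(3) s \<Omega>m \<Omega>fin S(4)[OF \<sigma>] S(6)[OF \<sigma>] gi Sg[OF \<sigma>] K])
  define v where "v n = \<sigma> (r n)" for n
  define l where "l x = lim (\<lambda>n. v n x)" for x
  have vS: "v n \<in> solution_set s p \<Omega> f ul uu" for n by (simp add: v_def \<sigma>)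
  have vm: "v n \<in> borel_measurable lebesgue" for n by (rule S(4)[OF vS])
  have lm: "l \<in> borel_measurable lebesgue"
    unfolding l_def[abs_def] by (rule borel_measurable_lim_metric) (rule vm)
  have vl: "AE x in lebesgue. (\<lambda>n. v n x) \<longlonglongrightarrow> l x"
    using r(2) unfolding v_def[symmetric]
    by eventually_elim (simp add: l_def Cauchy_convergent_iff convergent_LIMSEQ_iff)
  have l_prop: "AE x in lebesgue. P x (l x)"
    if "\<And>n. AE x in lebesgue. P x (v n x)" "\<And>x. closed {t. P x t}" for P :: "'a \<Rightarrow> real \<Rightarrow> bool"
  proof -
    have "AE x in lebesgue. \<forall>n. P x (v n x)" using that(1) by (simp add: AE_all_countable)
    then show ?thesis
      using vl
    proof eventually_elim
      case (elim x)
      then show ?case using closed_sequentially[OF that(2)[of x], of "\<lambda>n. v n x" "l x"] by simp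
    qed
  qed
  have closed_int: "closed {t. ul x \<le> t \<and> t \<le> uu x}" for x
    by (simp add: closed_Collect_conj closed_Collect_le continuous_on_const continuous_on_id)
  have l_between: "AE x in lebesgue. ul x \<le> l x \<and> l x \<le> uu x"
    by (rule l_prop[of "\<lambda>x t. ul x \<le> t \<and> t \<le> uu x", OF S(3)[OF vS] closed_int])
  have l_off: "AE x in lebesgue. x \<notin> \<Omega> \<longrightarrow> l x = 0"
    by (rule l_prop[of "\<lambda>x t. x \<notin> \<Omega> \<longrightarrow> t = 0", OF S(6)[OF vS]]) (simp add: closed_Collect_imp)
  have lg: "AE x in lebesgue. \<bar>l x\<bar> \<le> g x"
    using l_between l_off by eventually_elim (auto simp: g_def split: split_indicator)

  \<comment> \<open>\<open>J\<close> measures convergence in the weighted \<open>L^1\<close> space in which the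
    right-hand side of the equation is controlled.\<close>
  define J where "J n = (LINT x|lebesgue. ?m (\<lambda>x. v n x - l x) x)" for n
  have vl2: "AE x in lebesgue. \<bar>v n x - l x\<bar> \<le> 2 * g x" for n
    using Sg[OF vS[of n]] lg by eventually_elim auto
  have vv2: "AE x in lebesgue. \<bar>v i x - v j x\<bar> \<le> 2 * g x" for i j
    using Sg[OF vS[of i]] Sg[OF vS[of j]] by eventually_elim auto
  have vlm: "(\<lambda>x. v n x - l x) \<in> borel_measurable lebesgue" for n
    using vm lm by (rule borel_measurable_diff)
  have vvm: "(\<lambda>x. v i x - v j x) \<in> borel_measurable lebesgue" for i j
    using vm vm by (rule borel_measurable_diff)
  have J0: "J \<longlonglongrightarrow> 0"
  proof -
    have "(\<lambda>n. LINT x|lebesgue. ?m (\<lambda>x. v n x - l x) x) \<longlonglongrightarrow> (LINT x|(lebesgue :: 'a measure). 0)"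
    proof (rule integral_dominated_convergence)
      show "?m (\<lambda>x. v n x - l x) \<in> borel_measurable lebesgue" for n by (rule mm[OF vlm])
      show "integrable lebesgue (\<lambda>x. 4 * H x)" using Hi by simp
      show "AE x in lebesgue. (\<lambda>n. ?m (\<lambda>x. v n x - l x) x) \<longlonglongrightarrow> 0"
        using vl
      proof eventually_elim
        case (elim x)
        then have "(\<lambda>n. v n x - l x) \<longlonglongrightarrow> 0" by (simp add: LIM_zero)
        then have "(\<lambda>n. \<bar>v n x - l x\<bar>) \<longlonglongrightarrow> 0" by (rule tendsto_rabs_zero)
        then show ?case by (intro tendsto_mult_right_zero)
      qed
      show "AE x in lebesgue. norm (?m (\<lambda>x. v n x - l x) x) \<le> 4 * H x" for n
        using vl2[of n]
      proof eventually_elim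
        case (elim x)
        have "0 \<le> ?m (\<lambda>x. v n x - l x) x" by (simp add: add_nonneg_nonneg)
        then show ?case using mle[of "\<lambda>x. v n x - l x" x, OF elim] by simp
      qed
    qed simp
    then show ?thesis by (simp add: J_def[abs_def])
  qed

  define C where "C = 2 powr (p - 1) * (2 * c0)"
  have C0: "0 \<le> C" using c0 by (simp add: C_def)
  \<comment> \<open>Strong monotonicity, where the equation turns both operator terms into source terms.\<close>
  have Gij: "gagliardo_int s p UNIV (\<lambda>x. v i x - v j x) \<le> ennreal (C * (J i + J j))" for i j
  proof -
    let ?w = "\<lambda>x. v i x - v j x"
    have wW: "?w \<in> W0_sp s p \<Omega>" using S(1)[OF vS] S(1)[OF vS] by (rule W0_sp_diff[OF p0(3) \<Omega>(1)])
    have wi: "integrable lebesgue (?m ?w)" using vvm vv2 by (rule mi)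
    have "(LINT x|lebesgue. ?m ?w x) \<le> (LINT x|lebesgue. ?m (\<lambda>x. v i x - l x) x + ?m (\<lambda>x. v j x - l x) x)"
    proof (rule integral_mono)
      show "integrable lebesgue (\<lambda>x. ?m (\<lambda>x. v i x - l x) x + ?m (\<lambda>x. v j x - l x) x)"
        using mi[OF vlm vl2] mi[OF vlm vl2] by (rule Bochner_Integration.integrable_add)
      fix x
      have "(1 + g x powr (q - 1)) * \<bar>v i x - v j x\<bar> \<le> (1 + g x powr (q - 1)) * (\<bar>v i x - l x\<bar> + \<bar>v j x - l x\<bar>)"
        by (intro mult_left_mono) (auto simp: add_nonneg_nonneg)
      then show "?m ?w x \<le> ?m (\<lambda>x. v i x - l x) x + ?m (\<lambda>x. v j x - l x) x"
        by (auto simp: distrib_left split: split_indicator)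
    qed (rule wi)
    also have "\<dots> = J i + J j"
      unfolding J_def by (rule Bochner_Integration.integral_add[OF mi[OF vlm vl2] mi[OF vlm vl2]])
    finally have mw: "(LINT x|lebesgue. ?m ?w x) \<le> J i + J j" .
    have src: "\<bar>frac_p_laplacian s p (v k) ?w\<bar> \<le> c0 * (LINT x|lebesgue. ?m ?w x)" for k
      unfolding S(2)[OF vS wW] by (rule source_pairing_bound(2)[OF \<Omega>m q1(1) growth c0 Sg[OF vS[of k]] wi])
    have "c0 * (LINT x|lebesgue. ?m ?w x) \<le> c0 * (J i + J j)" by (rule mult_left_mono[OF mw c0])
    then have "frac_p_laplacian s p (v i) ?w - frac_p_laplacian s p (v j) ?w \<le> 2 * c0 * (J i + J j)"
      using src[of i] src[of j] by linarith
    then have "2 powr (p - 1) * (frac_p_laplacian s p (v i) ?w - frac_p_laplacian s p (v j) ?w) \<le> C * (J i + J j)"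
      unfolding C_def mult.assoc by (intro mult_left_mono) (auto simp: mult.assoc)
    moreover have "gagliardo_int s p UNIV ?w
        \<le> ennreal (2 powr (p - 1) * (frac_p_laplacian s p (v i) ?w - frac_p_laplacian s p (v j) ?w))"
      by (rule frac_p_laplacian_strongly_monotone[OF p vm S(5)[OF vS] vm S(5)[OF vS]])
    ultimately show ?thesis by (meson ennreal_leI order_trans)
  qed

  have Gl: "gagliardo_int s p UNIV (\<lambda>x. v i x - l x) \<le> ennreal (C * J i)" for i
  proof -
    have "AE x in lebesgue. (\<lambda>j. v i x - v j x) \<longlonglongrightarrow> v i x - l x"
      using vl by eventually_elim (intro tendsto_diff tendsto_const)
    then have "gagliardo_int s p UNIV (\<lambda>x. v i x - l x) \<le> liminf (\<lambda>j. gagliardo_int s p UNIV (\<lambda>x. v i x - v j x))"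
      by (rule gagliardo_int_fatou[OF p0(1) vvm])
    also have "\<dots> \<le> liminf (\<lambda>j. ennreal (C * (J i + J j)))"
      by (intro Liminf_mono always_eventually allI Gij)
    also have "\<dots> = ennreal (C * (J i + 0))"
      by (intro lim_imp_Liminf trivial_limit_sequentially tendsto_ennrealI tendsto_mult tendsto_add tendsto_const J0)
    finally show ?thesis by simp
  qed
  \<comment> \<open>\<open>l\<close> is the difference of \<open>v 0\<close> and \<open>v 0 - l\<close>, which both have finite energy.\<close>
  have lfin: "gagliardo_int s p UNIV l < \<infinity>"
  proof -
    have "gagliardo_int s p UNIV (\<lambda>x. v 0 x - (v 0 x - l x))
        \<le> ennreal (2 powr p) * (gagliardo_int s p UNIV (v 0) + gagliardo_int s p UNIV (\<lambda>x. v 0 x - l x))"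
      by (rule gagliardo_int_diff_le[OF p0(4) vm vlm])
    also have "\<dots> < \<infinity>"
      using S(5)[OF vS[of 0]] le_less_trans[OF Gl[of 0] ennreal_less_top] by (simp add: ennreal_mult_less_top)
    finally show ?thesis by simp
  qed
  have lW: "l \<in> W0_sp s p \<Omega>"
  proof -
    have "(\<integral>\<^sup>+x. ennreal (\<bar>l x\<bar> powr p) \<partial>lebesgue) \<le> (\<integral>\<^sup>+x. ennreal (H x) \<partial>lebesgue)"
    proof (rule nn_integral_mono_AE)
      show "AE x in lebesgue. ennreal (\<bar>l x\<bar> powr p) \<le> ennreal (H x)"
        using lg
      proof eventually_elim
        case (elim x)
        then have "\<bar>l x\<bar> powr p \<le> g x powr p" using p0 by (intro powr_mono2) auto
        then show ?case using gH(2)[of x] by (intro ennreal_leI) linarith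
      qed
    qed
    also have "\<dots> < \<infinity>" using Hi H0 by (simp add: nn_integral_eq_integral)
    finally show ?thesis using lm lfin l_off by (simp add: W0_sp_iff[OF \<Omega>(1)])
  qed

  have norm0: "(\<lambda>n. gagliardo_seminorm s p (\<lambda>x. v n x - l x)) \<longlonglongrightarrow> 0"
  proof (rule tendsto_sandwich)
    have J_nn: "0 \<le> J n" for n
      unfolding J_def by (intro integral_nonneg_AE AE_I2) (simp add: add_nonneg_nonneg)
    show "\<forall>\<^sub>F n in sequentially. 0 \<le> gagliardo_seminorm s p (\<lambda>x. v n x - l x)"
      by (simp add: gagliardo_seminorm_def)
    have "enn2real (gagliardo_int s p UNIV (\<lambda>x. v n x - l x)) \<le> C * J n" for n
      by (rule enn2real_leI[OF _ Gl]) (use C0 J_nn in simp)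
    then show "\<forall>\<^sub>F n in sequentially. gagliardo_seminorm s p (\<lambda>x. v n x - l x) \<le> (C * J n) powr (1 / p)"
      unfolding gagliardo_seminorm_def using p0 by (intro always_eventually allI powr_mono2) auto
    have "(\<lambda>n. (C * J n) powr (1 / p)) \<longlonglongrightarrow> (C * 0) powr (1 / p)"
      using p0 C0 J_nn by (intro tendsto_powr2 tendsto_mult tendsto_const J0) auto
    then show "(\<lambda>n. (C * J n) powr (1 / p)) \<longlonglongrightarrow> 0" by simp
  qed simp

  \<comment> \<open>A second subsequence along which the energies of \<open>v n - l\<close> are summable,
    as \<open>frac_p_laplacian_tendsto\<close> requires.\<close>
  have "\<exists>r'::nat \<Rightarrow> nat. strict_mono r' \<and> (\<forall>n. C * J (r' n) < (1 / 2) ^ n)"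
  proof -
    have "(\<lambda>n. C * J n) \<longlonglongrightarrow> C * 0" by (intro tendsto_mult tendsto_const J0)
    then have ev: "\<forall>\<^sub>F m in sequentially. C * J m < (1 / 2) ^ n" for n
      by (intro order_tendstoD) auto
    have "\<exists>m'>m. C * J m' < (1 / 2) ^ n" for m n
    proof -
      obtain N where "\<And>m. N \<le> m \<Longrightarrow> C * J m < (1 / 2) ^ n" using ev[of n] by (auto simp: eventually_sequentially)
      then show ?thesis by (intro exI[of _ "max N (Suc m)"]) auto
    qed
    then obtain h where h: "h m n > m \<and> C * J (h m n) < (1 / 2) ^ n" for m n by metis
    define r' where "r' = rec_nat (h 0 0) (\<lambda>n m. h m (Suc n))"
    have r': "r' 0 = h 0 0" "r' (Suc n) = h (r' n) (Suc n)" for n by (simp_all add: r'_def)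
    have "r' n < r' (Suc n)" for n using h r'(2) by metis
    moreover have "C * J (r' n) < (1 / 2) ^ n" for n using h r' by (cases n) metis+
    ultimately show ?thesis by (intro exI[of _ r']) (simp add: strict_mono_Suc_iff)
  qed
  then obtain r' where r': "strict_mono (r' :: nat \<Rightarrow> nat)" "\<And>n. C * J (r' n) < (1 / 2) ^ n" by blast
  have vl': "AE x in lebesgue. (\<lambda>n. v (r' n) x) \<longlonglongrightarrow> l x"
    using vl by eventually_elim (rule LIMSEQ_subseq_LIMSEQ[OF _ r'(1), unfolded comp_def])

  have l_eq: "frac_p_laplacian s p l w = (LINT x:\<Omega>|lebesgue. f x (l x) * w x)" if w: "w \<in> W0_sp s p \<Omega>" for w
  proof -
    have wm: "w \<in> borel_measurable lebesgue" and wfin: "gagliardo_int s p UNIV w < \<infinity>"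
      using w by (simp_all add: W0_sp_iff[OF \<Omega>(1)])
    have wq: "integrable lebesgue (\<lambda>x. indicator \<Omega> x * \<bar>w x\<bar> powr q)"
    proof -
      have "w \<in> W_sp s p UNIV" using w by (simp add: W0_sp_def)
      then show ?thesis using wm \<Omega> \<Omega>m p0 s ps q q1 by (intro W_sp_Lq_integrable[where U = UNIV]) auto
    qed
    have "(\<Sum>n. gagliardo_int s p UNIV (\<lambda>x. v (r' n) x - l x)) \<le> (\<Sum>n. ennreal ((1 / 2) ^ n))"
    proof (intro suminf_le summableI)
      show "gagliardo_int s p UNIV (\<lambda>x. v (r' n) x - l x) \<le> ennreal ((1 / 2) ^ n)" for n
        using Gl[of "r' n"] ennreal_leI[OF less_imp_le[OF r'(2)[of n]]] by (rule order_trans)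
    qed
    also have "\<dots> < \<infinity>"
      by (subst suminf_ennreal2) (auto intro!: summable_geometric)
    finally have lhs: "(\<lambda>n. frac_p_laplacian s p (v (r' n)) w) \<longlonglongrightarrow> frac_p_laplacian s p l w"
      by (intro frac_p_laplacian_tendsto[where u = "\<lambda>n. v (r' n)", OF p0(2) vm lm lfin wm wfin vl'])
    have "integrable lebesgue (?m w)"
    proof (rule Bochner_Integration.integrable_bound[OF _ mm[OF wm]])
      show "integrable lebesgue (\<lambda>x. H x + 2 * (indicator \<Omega> x * \<bar>w x\<bar> powr q))"
        using Hi wq by simp
      show "AE x in lebesgue. norm (?m w x) \<le> norm (H x + 2 * (indicator \<Omega> x * \<bar>w x\<bar> powr q))"
      proof (rule AE_I2)
        fix x
        have "g x powr (q - 1) * \<bar>w x\<bar> \<le> g x powr q + \<bar>w x\<bar> powr q"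
          by (rule powr_young[OF q1(1) g0]) simp
        moreover have "\<bar>w x\<bar> \<le> 1 + \<bar>w x\<bar> powr q" by (rule tq) simp
        ultimately have "(1 + g x powr (q - 1)) * \<bar>w x\<bar> \<le> 1 + g x powr q + 2 * \<bar>w x\<bar> powr q"
          by (simp add: distrib_right)
        then show "norm (?m w x) \<le> norm (H x + 2 * (indicator \<Omega> x * \<bar>w x\<bar> powr q))"
          using H0[of x] by (auto simp: H_def abs_mult split: split_indicator)
      qed
    qed
    then have "(\<lambda>n. LINT x:\<Omega>|lebesgue. f x (v (r' n) x) * w x) \<longlonglongrightarrow> (LINT x:\<Omega>|lebesgue. f x (l x) * w x)"
      by (rule source_pairing_tendsto[where u = "\<lambda>n. v (r' n)", OF f \<Omega>m q1(1) growth c0 vm Sg[OF vS] lm vl' wm])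
    then have "(\<lambda>n. frac_p_laplacian s p (v (r' n)) w) \<longlonglongrightarrow> (LINT x:\<Omega>|lebesgue. f x (l x) * w x)"
      unfolding S(2)[OF vS w] .
    with lhs show ?thesis by (rule LIMSEQ_unique)
  qed
  have "l \<in> solution_set s p \<Omega> f ul uu"
    using lW l_eq l_between by (simp add: solution_set_def solution_def)
  with r(1) show ?thesis by (rule that) (use norm0 in \<open>simp add: v_def\<close>)
qed

theorem lemma3p4:
  fixes \<Omega> :: "'a::euclidean_space set"
    and f :: "'a \<Rightarrow> real \<Rightarrow> real"
    and ul uu :: "'a \<Rightarrow> real"
    and s p q c0 :: real
  assumes "DIM('a) > 1"
    and "p \<ge> 2"
    and "0 < s" and "s < 1"
    and "real DIM('a) > p * s"
    and "open \<Omega>" and "connected \<Omega>" and "\<Omega> \<noteq> {}"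
    and "bounded \<Omega>"
    and "C11_boundary \<Omega>"
    and "caratheodory \<Omega> f"
    and "c0 > 0"
    and "p < q" and "q < p_star TYPE('a) s p"
    and "AE x in lebesgue_on \<Omega>. \<forall>t. \<bar>f x t\<bar> \<le> c0 * (1 + \<bar>t\<bar> powr (q - 1))"
    and "ul \<in> W_tilde s p \<Omega>" and "uu \<in> W_tilde s p \<Omega>"
    and "sub_supersolution_pair s p \<Omega> f ul uu"
  shows "compactin (W0_topology s p \<Omega>) (solution_set s p \<Omega> f ul uu // ae_eq)"
proof -
  let ?S = "solution_set s p \<Omega> f ul uu"
  interpret Metric_space "W0_sp s p \<Omega> // ae_eq" "W0_dist s p"
    using assms by (intro Metric_space_W0) auto
  have S_W: "?S \<subseteq> W0_sp s p \<Omega>" by (auto simp: solution_set_def)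
  have sub: "?S // ae_eq \<subseteq> W0_sp s p \<Omega> // ae_eq"
    using S_W by (auto simp: quotient_def)
  show ?thesis
    unfolding W0_topology_def compactin_sequentially
  proof (intro conjI allI impI sub)
    fix A :: "nat \<Rightarrow> ('a \<Rightarrow> real) set"
    assume A: "range A \<subseteq> ?S // ae_eq"
    then have "\<forall>n. \<exists>u. u \<in> ?S \<and> A n = ae_eq `` {u}" by (auto simp: quotient_def image_subset_iff)
    then obtain \<sigma> where \<sigma>: "\<And>n. \<sigma> n \<in> ?S" "\<And>n. A n = ae_eq `` {\<sigma> n}" by metis
    obtain r l where r: "strict_mono (r :: nat \<Rightarrow> nat)" "l \<in> ?S"
      "(\<lambda>n. gagliardo_seminorm s p (\<lambda>x. \<sigma> (r n) x - l x)) \<longlonglongrightarrow> 0"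
      by (rule solution_sequence_subconverges[where \<sigma> = \<sigma> and f = f and ul = ul and uu = uu and \<Omega> = \<Omega>
            and s = s and p = p and q = q])
         (use assms \<sigma>(1) in auto)
    have dist: "W0_dist s p (A (r n)) (ae_eq `` {l}) = gagliardo_seminorm s p (\<lambda>x. \<sigma> (r n) x - l x)" for n
      unfolding \<sigma>(2) using S_W \<sigma>(1) r(2) by (intro W0_dist_eq) auto
    have "ae_eq `` {l} \<in> ?S // ae_eq" using r(2) by (rule quotientI)
    moreover have "limitin mtopology (A \<circ> r) (ae_eq `` {l}) sequentially"
      unfolding limitin_metric_dist_null
    proof (intro conjI)
      show "ae_eq `` {l} \<in> W0_sp s p \<Omega> // ae_eq" using r(2) S_W by (intro quotientI) auto
      show "\<forall>\<^sub>F n in sequentially. (A \<circ> r) n \<in> W0_sp s p \<Omega> // ae_eq"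
        using A sub by (intro always_eventually) auto
      show "((\<lambda>n. W0_dist s p ((A \<circ> r) n) (ae_eq `` {l})) \<longlongrightarrow> 0) sequentially"
        using r(3) by (simp add: dist)
    qed
    ultimately show "\<exists>L r. L \<in> ?S // ae_eq \<and> strict_mono r \<and> limitin mtopology (A \<circ> r) L sequentially"
      using r(1) by blast
  qed
qed

end
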